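(* Let $\tau$ be a given mean trajectory and consider the convex chance-constrained covariance subproblem $$\min_{S_k(i),\,\Sigma_k,\,L_k(i),\,Y_k(i),\,\zeta_{m,k}}\ J_\Sigma^c=\sum_{k=0}^{T-1}\sum_{i\in\mathcal S}\mathrm{Tr}\big(S_k(i)Q_k+Y_k(i)R_k\big)+\sum_{m=1}^4\alpha_m\|\zeta_m\|_1$$ subject to, for all $k\in\{0,\dots,T-1\}$, all $i,l\in\mathcal S$ and all half-space constraint indices $j$, $$S_{k+1}(l)=\sum_{i\in\mathcal S}p_{il}\Big\{A_k(i)S_k(i)A_k^\top(i)+A_k(i)L_k^\top(i)B_k^\top(i)+B_k(i)L_k(i)A_k^\top(i)+B_k(i)Y_k(i)B_k^\top(i)+\rho_k(i)m_k(i)m_k^\top(i)+\rho_k(i)G_k(i)G_k^\top(i)\Big\}-\rho_{k+1}(l)\overline x_{k+1}(l)\overline x_{k+1}^\top(l),$$ $$\begin{bmatrix}Y_k(i)&L_k(i)\\ L_k^\top(i)&S_k(i)\end{bmatrix}\succeq 0,\qquad S_0(i)=\rho_0(i)\Sigma_0^{\mathrm{init}},\qquad \Sigma_T\preceq\Sigma_f,$$ $$\Sigma_k=\sum_{i\in\mathcal S}\big(S_k(i)+\rho_k(i)(\overline x_k(i)-\mu_k)(\overline x_k(i)-\mu_k)^\top\big)\quad (\text{for } 0\le k\le T),$$ $$\frac{1-\delta_{x,j}}{\delta_{x,j}}a_j^\top\Sigma_ka_j-(a_j^\top\mu_k+b_j)^2\le\zeta_{1,k},\qquad \frac{1-\delta_{u,j}(i)}{\delta_{u,j}(i)}f_j^\top\frac{Y_k(i)}{\rho_k(i)}f_j-(f_j^\top\overline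 u_k(i)+g_j)^2\le\zeta_{2,k},$$ $$\frac{n_x}{\epsilon_x}\lambda_{\max}(\Sigma_k)-d_{\max}^2\le\zeta_{3,k},\qquad \frac{n_u}{\epsilon_u(i)}\lambda_{\max}\Big(\frac{Y_k(i)}{\rho_k(i)}\Big)-\big(u_{\max}(i)-\|\overline u_k(i)\|\big)^2\le\zeta_{4,k},\qquad \zeta_{m,k}\ge0,$$ where $m_k(i)=A_k(i)\overline x_k(i)+B_k(i)\overline u_k(i)+c_k(i)$ and $\zeta_m=[\zeta_{m,0},\dots,\zeta_{m,T-1}]^\top$. Assume that (1) $\rho_k(i)>0$ for all $k\in\{0,\dots,T\}$, $i\in\mathcal S$; (2) $S_k(i)\succ0$ for all $k\in\{0,\dots,T\}$, $i\in\mathcal S$; (3) Slater's condition holds for this problem with $\zeta_m=0$ for all $m$, i.e. there is a point satisfying all equality constraints and satisfying strictly all the inequality and matrix-inequality constraints on $S_k(i),\Sigma_k,L_k(i),Y_k(i)$ with the slacks set to zero. Then every optimal solution of this problem satisfies $$Y_k(i)=L_k(i)S_k^{-1}(i)L_k^\top(i)\qquad\text{for all }k\in\{0,\dots,T-1\},\ i\in\mathcal S.$$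
   Context: Setting. $T\ge1$ is a finite horizon, $\mathcal S=\{1,\dots,N\}$ is the set of modes, and $\mathcal P=(p_{ij})_{i,j\in\mathcal S}$ is a (row-)stochastic transition matrix. $\rho_0$ is an initial probability row vector on $\mathcal S$ and $\rho_k=\rho_0\mathcal P^k$, with entries $\rho_k(i)$. For each $k$ and $i$: $A_k(i)\in\mathbb R^{n_x\times n_x}$ is invertible, $B_k(i)\in\mathbb R^{n_x\times n_u}$, $c_k(i)\in\mathbb R^{n_x}$, $G_k(i)\in\mathbb R^{n_x\times n_w}$. The cost matrices are symmetric with $Q_k\succeq0$ and $R_k\succ0$. $\Sigma_0^{\mathrm{init}},\Sigma_f$ are given symmetric $n_x\times n_x$ matrices (initial covariance and terminal covariance bound). These data come from the Markov jump linear system $x_{k+1}=A_k(r_k)x_k+B_k(r_k)u_k+c_k(r_k)+G_k(r_k)w_k$, where $r_k$ is the Markov chain and $w_k$ is zero-mean white noise with identity covariance. Mean trajectory $\tau$: vectors $\mu_k,\overline x_k(i)\in\mathbb R^{n_x}$ ($0\le k\le T$) and $\overline u_k(i)\in\mathbb R^{n_u}$ ($0\le k\le T-1$), $i\in\mathcal S$, such that with $q_k(i)=\rho_k(i)\overline x_k(i)$ one has $\mu_k=\sum_{i}q_k(i)$ and $q_{k+1}(j)=\sum_{i}p_{ij}\big(A_k(i)q_k(i)+\rho_k(i)(B_k(i)\overline u_k(i)+c_k(i))\big)$. The mean trajectory is fixed data in the problem. Chance-constraint data (all fixed): finitely many half-spaces for the state ($a_j\in\mathbb R^{n_x}$, $b_j\in\mathbb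 R$) and for the control ($f_j\in\mathbb R^{n_u}$, $g_j\in\mathbb R$); risk levels $\delta_{x,j},\delta_{u,j}(i)\in(0,1)$ with $\sum_j\delta_{x,j}\le\delta_x$ and $\sum_j\delta_{u,j}(i)\le\delta_u(i)$; risk levels $\epsilon_x,\epsilon_u(i)\in(0,1)$; bounds $d_{\max}>0$ and $u_{\max}(i)>0$; penalty weights $\alpha_m>0$. For each constraint type $m\in\{1,2,3,4\}$ there is one scalar slack variable $\zeta_{m,k}$ per time step $k\in\{0,\dots,T-1\}$. Decision variables: symmetric $S_k(i)\in\mathbb R^{n_x\times n_x}$ and $\Sigma_k$ ($0\le k\le T$), $L_k(i)\in\mathbb R^{n_u\times n_x}$ and symmetric $Y_k(i)\in\mathbb R^{n_u\times n_u}$ ($0\le k\le T-1$), and the slacks $\zeta_{m,k}$. Assumption (2) is a standing assumption that the matrices $S_k(i)$ of the solutions under consideration are positive definite. $\lambda_{\max}$ is the largest eigenvalue, $\|\cdot\|$ the Euclidean norm, $\|\cdot\|_1$ the $\ell_1$ norm; $\succeq,\preceq$ (resp. $\succ,\prec$) denote the positive semidefinite (resp. definite) order on symmetric matrices. *)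

theory Defs
  imports "HOL-Analysis.Analysis"
begin

definition symmetric_mat :: "real^'n^'n \<Rightarrow> bool" where
  "symmetric_mat M \<longleftrightarrow> transpose M = M"

definition pos_semidef :: "real^'n^'n \<Rightarrow> bool" where
  "pos_semidef M \<longleftrightarrow> symmetric_mat M \<and> (\<forall>v. 0 \<le> v \<bullet> (M *v v))"

definition pos_def :: "real^'n^'n \<Rightarrow> bool" where
  "pos_def M \<longleftrightarrow> symmetric_mat M \<and> (\<forall>v. v \<noteq> 0 \<longrightarrow> 0 < v \<bullet> (M *v v))"

definition eigenvalue_of :: "real^'n^'n \<Rightarrow> real \<Rightarrow> bool" where
  "eigenvalue_of M c \<longleftrightarrow> (\<exists>v. v \<noteq> 0 \<and> M *v v = c *\<^sub>R v)"

text \<open>Only real eigenvalues are collected, so this is meant for symmetric matrices; for those the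
  set is finite and nonempty and \<^const>\<open>Max\<close> is its largest element.\<close>

definition lambda_max :: "real^'n^'n \<Rightarrow> real" where
  "lambda_max M = Max {c. eigenvalue_of M c}"

definition outer_prod :: "real^'n \<Rightarrow> real^'m \<Rightarrow> real^'m^'n" where
  "outer_prod v w = (\<chi> i j. v $ i * w $ j)"

definition block_mat ::
  "real^'u^'u \<Rightarrow> real^'x^'u \<Rightarrow> real^'u^'x \<Rightarrow> real^'x^'x \<Rightarrow> real^('u + 'x)^('u + 'x)" where
  "block_mat M11 M12 M21 M22 = (\<chi> i j. case i of
      Inl a \<Rightarrow> (case j of Inl b \<Rightarrow> M11 $ a $ b | Inr b \<Rightarrow> M12 $ a $ b)
    | Inr a \<Rightarrow> (case j of Inl b \<Rightarrow> M21 $ a $ b | Inr b \<Rightarrow> M22 $ a $ b))"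

text \<open>The finite types \<open>'x\<close>, \<open>'u\<close>, \<open>'w\<close> index the state, control and noise coordinates
  (so \<open>n_x = CARD('x)\<close> etc.) and \<open>'s\<close> is the set of modes. Time is a natural number;
  components are meaningful only for times within the horizon. Half-spaces are numbered from
  \<open>0\<close> to \<open>num_xhs - 1\<close> (state) and \<open>0\<close> to \<open>num_uhs - 1\<close> (control).\<close>

record ('x::finite, 'u::finite, 'w::finite, 's::finite) mjls_data =
  horizon :: nat
  trans_mat :: "real^'s^'s"
  rho_init :: "real^'s"
  dynA :: "nat \<Rightarrow> 's \<Rightarrow> real^'x^'x"
  dynB :: "nat \<Rightarrow> 's \<Rightarrow> real^'u^'x"
  dync :: "nat \<Rightarrow> 's \<Rightarrow> real^'x"
  dynG :: "nat \<Rightarrow> 's \<Rightarrow> real^'w^'x"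
  costQ :: "nat \<Rightarrow> real^'x^'x"
  costR :: "nat \<Rightarrow> real^'u^'u"
  Sigma_init :: "real^'x^'x"
  Sigma_fin :: "real^'x^'x"
  mu :: "nat \<Rightarrow> real^'x"
  xbar :: "nat \<Rightarrow> 's \<Rightarrow> real^'x"
  ubar :: "nat \<Rightarrow> 's \<Rightarrow> real^'u"
  num_xhs :: nat
  a_vec :: "nat \<Rightarrow> real^'x"
  b_off :: "nat \<Rightarrow> real"
  num_uhs :: nat
  f_vec :: "nat \<Rightarrow> real^'u"
  g_off :: "nat \<Rightarrow> real"
  delta_xj :: "nat \<Rightarrow> real"
  delta_x :: real
  delta_uj :: "nat \<Rightarrow> 's \<Rightarrow> real"
  delta_u :: "'s \<Rightarrow> real"
  eps_x :: real
  eps_u :: "'s \<Rightarrow> real"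
  d_max :: real
  u_max :: "'s \<Rightarrow> real"
  penalty :: "nat \<Rightarrow> real"

primrec rho :: "('x::finite, 'u::finite, 'w::finite, 's::finite) mjls_data \<Rightarrow> nat \<Rightarrow> real^'s" where
  "rho d 0 = rho_init d"
| "rho d (Suc k) = rho d k v* trans_mat d"

definition valid_data :: "('x::finite, 'u::finite, 'w::finite, 's::finite) mjls_data \<Rightarrow> bool" where
  "valid_data d \<longleftrightarrow>
     1 \<le> horizon d \<and>
     (\<forall>i j. 0 \<le> trans_mat d $ i $ j) \<and> (\<forall>i. (\<Sum>j\<in>UNIV. trans_mat d $ i $ j) = 1) \<and>
     (\<forall>i. 0 \<le> rho_init d $ i) \<and> (\<Sum>i\<in>UNIV. rho_init d $ i) = 1 \<and>
     (\<forall>k<horizon d. \<forall>i. invertible (dynA d k i)) \<and>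
     (\<forall>k<horizon d. pos_semidef (costQ d k)) \<and>
     (\<forall>k<horizon d. pos_def (costR d k)) \<and>
     symmetric_mat (Sigma_init d) \<and> symmetric_mat (Sigma_fin d) \<and>
     (\<forall>j<num_xhs d. 0 < delta_xj d j \<and> delta_xj d j < 1) \<and>
     (\<Sum>j<num_xhs d. delta_xj d j) \<le> delta_x d \<and>
     (\<forall>j<num_uhs d. \<forall>i. 0 < delta_uj d j i \<and> delta_uj d j i < 1) \<and>
     (\<forall>i. (\<Sum>j<num_uhs d. delta_uj d j i) \<le> delta_u d i) \<and>
     0 < eps_x d \<and> eps_x d < 1 \<and> (\<forall>i. 0 < eps_u d i \<and> eps_u d i < 1) \<and>
     0 < d_max d \<and> (\<forall>i. 0 < u_max d i) \<and>
     (\<forall>m\<in>{1..4}. 0 < penalty d m)"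

definition q_vec ::
  "('x::finite, 'u::finite, 'w::finite, 's::finite) mjls_data \<Rightarrow> nat \<Rightarrow> 's \<Rightarrow> real^'x" where
  "q_vec d k i = (rho d k $ i) *\<^sub>R xbar d k i"

definition mean_trajectory ::
  "('x::finite, 'u::finite, 'w::finite, 's::finite) mjls_data \<Rightarrow> bool" where
  "mean_trajectory d \<longleftrightarrow>
     (\<forall>k\<le>horizon d. mu d k = (\<Sum>i\<in>UNIV. q_vec d k i)) \<and>
     (\<forall>k<horizon d. \<forall>j. q_vec d (Suc k) j =
        (\<Sum>i\<in>UNIV. (trans_mat d $ i $ j) *\<^sub>R
           (dynA d k i *v q_vec d k i
            + (rho d k $ i) *\<^sub>R (dynB d k i *v ubar d k i + dync d k i))))"

definition m_vec ::
  "('x::finite, 'u::finite, 'w::finite, 's::finite) mjls_data \<Rightarrow> nat \<Rightarrow> 's \<Rightarrow> real^'x" where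
  "m_vec d k i = dynA d k i *v xbar d k i + dynB d k i *v ubar d k i + dync d k i"

text \<open>\<open>slack v m k\<close> is the slack of constraint type \<open>m\<close> (between \<open>1\<close> and \<open>4\<close>) at time \<open>k\<close>.\<close>

record ('x::finite, 'u::finite, 's::finite) decision =
  varS :: "nat \<Rightarrow> 's \<Rightarrow> real^'x^'x"
  varSigma :: "nat \<Rightarrow> real^'x^'x"
  varL :: "nat \<Rightarrow> 's \<Rightarrow> real^'x^'u"
  varY :: "nat \<Rightarrow> 's \<Rightarrow> real^'u^'u"
  slack :: "nat \<Rightarrow> nat \<Rightarrow> real"

definition symmetric_vars ::
  "('x::finite, 'u::finite, 'w::finite, 's::finite) mjls_data \<Rightarrow> ('x, 'u, 's) decision \<Rightarrow> bool" where
  "symmetric_vars d v \<longleftrightarrow>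
     (\<forall>k\<le>horizon d. symmetric_mat (varSigma v k) \<and> (\<forall>i. symmetric_mat (varS v k i))) \<and>
     (\<forall>k<horizon d. \<forall>i. symmetric_mat (varY v k i))"

definition equality_constraints ::
  "('x::finite, 'u::finite, 'w::finite, 's::finite) mjls_data \<Rightarrow> ('x, 'u, 's) decision \<Rightarrow> bool" where
  "equality_constraints d v \<longleftrightarrow>
     (\<forall>k<horizon d. \<forall>l. varS v (Suc k) l =
        (\<Sum>i\<in>UNIV. (trans_mat d $ i $ l) *\<^sub>R
           (dynA d k i ** varS v k i ** transpose (dynA d k i)
            + dynA d k i ** transpose (varL v k i) ** transpose (dynB d k i)
            + dynB d k i ** varL v k i ** transpose (dynA d k i)
            + dynB d k i ** varY v k i ** transpose (dynB d k i)
            + (rho d k $ i) *\<^sub>R outer_prod (m_vec d k i) (m_vec d k i)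
            + (rho d k $ i) *\<^sub>R (dynG d k i ** transpose (dynG d k i))))
        - (rho d (Suc k) $ l) *\<^sub>R outer_prod (xbar d (Suc k) l) (xbar d (Suc k) l)) \<and>
     (\<forall>i. varS v 0 i = (rho d 0 $ i) *\<^sub>R Sigma_init d) \<and>
     (\<forall>k\<le>horizon d. varSigma v k =
        (\<Sum>i\<in>UNIV. varS v k i
           + (rho d k $ i) *\<^sub>R outer_prod (xbar d k i - mu d k) (xbar d k i - mu d k)))"

definition state_hs_lhs ::
  "('x::finite, 'u::finite, 'w::finite, 's::finite) mjls_data \<Rightarrow> ('x, 'u, 's) decision
    \<Rightarrow> nat \<Rightarrow> nat \<Rightarrow> real" where
  "state_hs_lhs d v k j =
     (1 - delta_xj d j) / delta_xj d j * (a_vec d j \<bullet> (varSigma v k *v a_vec d j))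
     - (a_vec d j \<bullet> mu d k + b_off d j)\<^sup>2"

definition control_hs_lhs ::
  "('x::finite, 'u::finite, 'w::finite, 's::finite) mjls_data \<Rightarrow> ('x, 'u, 's) decision
    \<Rightarrow> nat \<Rightarrow> 's \<Rightarrow> nat \<Rightarrow> real" where
  "control_hs_lhs d v k i j =
     (1 - delta_uj d j i) / delta_uj d j i
       * (f_vec d j \<bullet> (((1 / rho d k $ i) *\<^sub>R varY v k i) *v f_vec d j))
     - (f_vec d j \<bullet> ubar d k i + g_off d j)\<^sup>2"

definition state_norm_lhs ::
  "('x::finite, 'u::finite, 'w::finite, 's::finite) mjls_data \<Rightarrow> ('x, 'u, 's) decision
    \<Rightarrow> nat \<Rightarrow> real" where
  "state_norm_lhs d v k =
     real CARD('x) / eps_x d * lambda_max (varSigma v k) - (d_max d)\<^sup>2"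

definition control_norm_lhs ::
  "('x::finite, 'u::finite, 'w::finite, 's::finite) mjls_data \<Rightarrow> ('x, 'u, 's) decision
    \<Rightarrow> nat \<Rightarrow> 's \<Rightarrow> real" where
  "control_norm_lhs d v k i =
     real CARD('u) / eps_u d i * lambda_max ((1 / rho d k $ i) *\<^sub>R varY v k i)
     - (u_max d i - norm (ubar d k i))\<^sup>2"

definition feasible ::
  "('x::finite, 'u::finite, 'w::finite, 's::finite) mjls_data \<Rightarrow> ('x, 'u, 's) decision \<Rightarrow> bool" where
  "feasible d v \<longleftrightarrow>
     symmetric_vars d v \<and> equality_constraints d v \<and>
     (\<forall>k<horizon d. \<forall>i. pos_semidef
        (block_mat (varY v k i) (varL v k i) (transpose (varL v k i)) (varS v k i))) \<and>
     pos_semidef (Sigma_fin d - varSigma v (horizon d)) \<and>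
     (\<forall>k<horizon d. \<forall>j<num_xhs d. state_hs_lhs d v k j \<le> slack v 1 k) \<and>
     (\<forall>k<horizon d. \<forall>i. \<forall>j<num_uhs d. control_hs_lhs d v k i j \<le> slack v 2 k) \<and>
     (\<forall>k<horizon d. state_norm_lhs d v k \<le> slack v 3 k) \<and>
     (\<forall>k<horizon d. \<forall>i. control_norm_lhs d v k i \<le> slack v 4 k) \<and>
     (\<forall>m\<in>{1..4}. \<forall>k<horizon d. 0 \<le> slack v m k)"

definition slater_point ::
  "('x::finite, 'u::finite, 'w::finite, 's::finite) mjls_data \<Rightarrow> ('x, 'u, 's) decision \<Rightarrow> bool" where
  "slater_point d v \<longleftrightarrow>
     symmetric_vars d v \<and> equality_constraints d v \<and>
     (\<forall>m\<in>{1..4}. \<forall>k<horizon d. slack v m k = 0) \<and>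
     (\<forall>k<horizon d. \<forall>i. pos_def
        (block_mat (varY v k i) (varL v k i) (transpose (varL v k i)) (varS v k i))) \<and>
     pos_def (Sigma_fin d - varSigma v (horizon d)) \<and>
     (\<forall>k<horizon d. \<forall>j<num_xhs d. state_hs_lhs d v k j < slack v 1 k) \<and>
     (\<forall>k<horizon d. \<forall>i. \<forall>j<num_uhs d. control_hs_lhs d v k i j < slack v 2 k) \<and>
     (\<forall>k<horizon d. state_norm_lhs d v k < slack v 3 k) \<and>
     (\<forall>k<horizon d. \<forall>i. control_norm_lhs d v k i < slack v 4 k)"

definition slater_condition ::
  "('x::finite, 'u::finite, 'w::finite, 's::finite) mjls_data \<Rightarrow> bool" where
  "slater_condition d \<longleftrightarrow> (\<exists>v. slater_point d v)"

definition objective ::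
  "('x::finite, 'u::finite, 'w::finite, 's::finite) mjls_data \<Rightarrow> ('x, 'u, 's) decision \<Rightarrow> real" where
  "objective d v =
     (\<Sum>k<horizon d. \<Sum>i\<in>UNIV. trace (varS v k i ** costQ d k) + trace (varY v k i ** costR d k))
     + (\<Sum>m=1..4. penalty d m * (\<Sum>k<horizon d. \<bar>slack v m k\<bar>))"

definition optimal_solution ::
  "('x::finite, 'u::finite, 'w::finite, 's::finite) mjls_data \<Rightarrow> ('x, 'u, 's) decision \<Rightarrow> bool" where
  "optimal_solution d v \<longleftrightarrow>
     feasible d v \<and> (\<forall>v'. feasible d v' \<longrightarrow> objective d v \<le> objective d v')"

end

theory Submission
  imports Defs
begin

text \<open>
  The proof perturbs an optimal solution directly and uses no multipliers.

  Suppose that at some time and mode the Schur complement \<open>D = Y - L S\<^sup>-\<^sup>1 L\<^sup>T\<close> is not zero. It is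
  positive semidefinite, so \<open>p p\<^sup>T \<preceq> D\<close> for some \<open>p \<noteq> 0\<close>
  (\<open>nonzero_Schur_complement_dominates_rank_one\<close>). Let \<open>g = A\<^sup>-\<^sup>1 B p\<close> and replace \<open>Y\<close> by
  \<open>Y - 2 \<epsilon> p p\<^sup>T\<close> and \<open>L\<close> by \<open>L + \<epsilon> p g\<^sup>T\<close>, keeping every \<open>S\<close>. The invertibility of \<open>A\<close> makes the two
  changes cancel in the recursion for \<open>S\<close> (\<open>successor_moment_covariance_neutral_step\<close>). The control
  constraints are only relaxed, and the cost falls by \<open>2 \<epsilon> p\<^sup>T R p\<close>, which is positive as \<open>R\<close> is
  positive definite.

  Only the block inequality can fail. Because the original block form dominates \<open>(p\<^sup>T y)\<^sup>2\<close>, its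
  defect is at most \<open>2 \<epsilon>\<^sup>2 (g\<^sup>T x)\<^sup>2\<close> (\<open>LMI_defect_covariance_neutral_step\<close>). At a Slater point the block
  matrices are positive definite, so a convex combination with weight of order \<open>\<epsilon>\<^sup>2\<close> on that point
  removes the defect. All constraints are convex, hence the combination is feasible; it costs at
  most an additional amount of order \<open>\<epsilon>\<^sup>2\<close>, which the linear gain outweighs for small \<open>\<epsilon>\<close>. This
  contradicts optimality (\<open>optimal_dominated_direction_eq_0\<close>).

  Convexity of the constraints on the largest eigenvalue rests on the equivalence of
  \<open>\<lambda>\<^sub>m\<^sub>a\<^sub>x(M) \<le> c\<close> with \<open>v\<^sup>T M v \<le> c \<parallel>v\<parallel>\<^sup>2\<close> for all \<open>v\<close> (\<open>lambda_max_le_iff\<close>).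
\<close>

section \<open>Quadratic forms of symmetric matrices\<close>

lemma inner_symmetric_mat_commute:
  fixes M :: "real^'n^'n"
  assumes "symmetric_mat M"
  shows "x \<bullet> (M *v y) = y \<bullet> (M *v x)"
proof -
  have "x \<bullet> (M *v y) = (x v* M) \<bullet> y"
    by (simp add: dot_lmul_matrix)
  also have "x v* M = M *v x"
    using assms unfolding symmetric_mat_def by (metis transpose_matrix_vector)
  finally show ?thesis
    by (simp add: inner_commute)
qed

lemma quadratic_form_add_scaleR:
  fixes M :: "real^'n^'n"
  assumes "symmetric_mat M"
  shows "(x + t *\<^sub>R y) \<bullet> (M *v (x + t *\<^sub>R y))
    = x \<bullet> (M *v x) + 2 * t * (y \<bullet> (M *v x)) + t\<^sup>2 * (y \<bullet> (M *v y))"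
  by (simp add: matrix_vector_right_distrib matrix_vector_mult_scaleR inner_add_left
      inner_add_right inner_symmetric_mat_commute[OF assms, of x y] power2_eq_square algebra_simps)

text \<open>The quadratic polynomial \<open>t \<mapsto> (x + t y)\<^sup>T M (x + t y)\<close> is nonnegative everywhere, so its
  discriminant is not positive.\<close>

lemma pos_semidef_Cauchy_Schwarz:
  fixes M :: "real^'n^'n"
  assumes "pos_semidef M"
  shows "(x \<bullet> (M *v y))\<^sup>2 \<le> (x \<bullet> (M *v x)) * (y \<bullet> (M *v y))"
proof -
  have sym: "symmetric_mat M" and nonneg: "\<And>z. 0 \<le> z \<bullet> (M *v z)"
    using assms unfolding pos_semidef_def by auto
  define a b c where "a = y \<bullet> (M *v y)" and "b = x \<bullet> (M *v y)" and "c = x \<bullet> (M *v x)"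
  have poly: "0 \<le> c + 2 * t * b + t\<^sup>2 * a" for t
    using nonneg[of "x + t *\<^sub>R y"] quadratic_form_add_scaleR[OF sym, of x t y]
      inner_symmetric_mat_commute[OF sym, of x y] unfolding a_def b_def c_def by simp
  have "0 \<le> a" and "0 \<le> c"
    unfolding a_def c_def using nonneg by auto
  have "b\<^sup>2 \<le> c * a"
  proof (cases "a = 0")
    case True
    have "b = 0"
    proof (rule ccontr)
      assume "b \<noteq> 0"
      then have "c + 2 * (- (c + 1) / b) * b = - c - 2"
        by (simp add: field_simps)
      then show False
        using poly[of "- (c + 1) / b"] True \<open>0 \<le> c\<close> by simp
    qed
    then show ?thesis using True by simp
  next
    case False
    then have "a > 0" using \<open>0 \<le> a\<close> by simp
    then have "c + 2 * (- b / a) * b + (- b / a)\<^sup>2 * a = (c * a - b\<^sup>2) / a"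
      by (simp add: field_simps power2_eq_square)
    then have "0 \<le> (c * a - b\<^sup>2) / a"
      using poly[of "- b / a"] by simp
    then show ?thesis
      using \<open>a > 0\<close> by (simp add: zero_le_divide_iff)
  qed
  then show ?thesis unfolding a_def b_def c_def .
qed

lemma pos_semidef_isotropic_imp_kernel:
  fixes M :: "real^'n^'n"
  assumes "pos_semidef M" and "v \<bullet> (M *v v) = 0"
  shows "M *v v = 0"
  using pos_semidef_Cauchy_Schwarz[OF assms(1), of "M *v v" v] assms(2) by simp

text \<open>A minimiser on the compact unit sphere exists, and homogeneity of degree two turns its value
  into a bound on all vectors.\<close>

lemma quadratic_form_on_sphere_attains_inf:
  fixes M :: "real^'n^'n"
  obtains w where "norm w = 1" and "\<And>v. (w \<bullet> (M *v w)) * (norm v)\<^sup>2 \<le> v \<bullet> (M *v v)"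
proof -
  have "(axis undefined 1 :: real^'n) \<in> sphere 0 1"
    by simp
  then have "(sphere 0 1 :: (real^'n) set) \<noteq> {}"
    by blast
  moreover have "continuous_on (sphere 0 1) (\<lambda>w. w \<bullet> (M *v w))"
    by (intro continuous_on_inner continuous_on_id linear_continuous_on
        matrix_vector_mul_bounded_linear)
  ultimately have "\<exists>w\<in>sphere 0 1. \<forall>v\<in>sphere 0 1. w \<bullet> (M *v w) \<le> v \<bullet> (M *v v)"
    by (intro continuous_attains_inf compact_sphere)
  then obtain w where w: "w \<in> sphere 0 1"
      "\<And>v. v \<in> sphere 0 1 \<Longrightarrow> w \<bullet> (M *v w) \<le> v \<bullet> (M *v v)"
    by blast
  have "(w \<bullet> (M *v w)) * (norm v)\<^sup>2 \<le> v \<bullet> (M *v v)" for v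
  proof (cases "v = 0")
    case False
    have "w \<bullet> (M *v w) \<le> (v /\<^sub>R norm v) \<bullet> (M *v (v /\<^sub>R norm v))"
      using w(2)[of "v /\<^sub>R norm v"] False by simp
    also have "\<dots> = (v \<bullet> (M *v v)) / (norm v)\<^sup>2"
      by (simp add: matrix_vector_mult_scaleR field_simps power2_eq_square)
    finally show ?thesis
      using False by (simp add: pos_le_divide_eq)
  qed simp
  then show thesis
    using that[of w] w(1) by simp
qed

text \<open>A positive definite form is bounded below by a positive multiple of \<open>\<parallel>w\<parallel>\<^sup>2\<close>, and Cauchy-Schwarz
  bounds \<open>(b\<^sup>T w)\<^sup>2\<close> by a multiple of \<open>\<parallel>w\<parallel>\<^sup>2\<close>. This measures how much of a Slater point suffices
  to repair a defect of rank one.\<close>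

lemma pos_def_dominates_rank_one:
  fixes M :: "real^'n^'n"
  assumes "pos_def M"
  obtains C where "0 \<le> C" and "\<And>w. (b \<bullet> w)\<^sup>2 \<le> C * (w \<bullet> (M *v w))"
proof -
  obtain u where u: "norm u = 1" "\<And>v. (u \<bullet> (M *v u)) * (norm v)\<^sup>2 \<le> v \<bullet> (M *v v)"
    using quadratic_form_on_sphere_attains_inf by blast
  define l where "l = u \<bullet> (M *v u)"
  have "u \<noteq> 0"
    using u(1) by auto
  then have "l > 0"
    using assms unfolding pos_def_def l_def by blast
  have "(b \<bullet> w)\<^sup>2 \<le> (norm b)\<^sup>2 / l * (w \<bullet> (M *v w))" for w
  proof -
    have "(b \<bullet> w)\<^sup>2 \<le> (norm b)\<^sup>2 * (norm w)\<^sup>2"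
      using Cauchy_Schwarz_ineq[of b w] by (simp add: power2_norm_eq_inner)
    also have "\<dots> = (norm b)\<^sup>2 / l * (l * (norm w)\<^sup>2)"
      using \<open>l > 0\<close> by simp
    also have "\<dots> \<le> (norm b)\<^sup>2 / l * (w \<bullet> (M *v w))"
      using u(2)[of w] \<open>l > 0\<close> unfolding l_def by (intro mult_left_mono) auto
    finally show ?thesis .
  qed
  then show thesis
    using that[of "(norm b)\<^sup>2 / l"] \<open>l > 0\<close> by simp
qed

text \<open>For a nonzero positive semidefinite \<open>D\<close> choose \<open>w\<close> with \<open>w\<^sup>T D w > 0\<close>; by Cauchy-Schwarz for the
  form of \<open>D\<close>, the vector \<open>p = D w / \<surd>(w\<^sup>T D w)\<close> satisfies \<open>p p\<^sup>T \<preceq> D\<close>.\<close>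

lemma nonzero_pos_semidef_dominates_rank_one:
  fixes D :: "real^'n^'n"
  assumes "pos_semidef D" and "D \<noteq> 0"
  obtains p where "p \<noteq> 0" and "\<And>y. (p \<bullet> y)\<^sup>2 \<le> y \<bullet> (D *v y)"
proof -
  obtain w where "D *v w \<noteq> 0"
    using assms(2) matrix_eq[of D 0] by auto
  then have pos: "w \<bullet> (D *v w) > 0"
    using pos_semidef_isotropic_imp_kernel[OF assms(1), of w] assms(1)
    unfolding pos_semidef_def by (metis less_eq_real_def)
  define p where "p = (1 / sqrt (w \<bullet> (D *v w))) *\<^sub>R (D *v w)"
  have "p \<noteq> 0"
    unfolding p_def using pos \<open>D *v w \<noteq> 0\<close> by simp
  moreover have "(p \<bullet> y)\<^sup>2 \<le> y \<bullet> (D *v y)" for y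
  proof -
    have "(p \<bullet> y)\<^sup>2 = (y \<bullet> (D *v w))\<^sup>2 / (w \<bullet> (D *v w))"
      unfolding p_def using pos by (simp add: power_divide inner_commute)
    also have "\<dots> \<le> y \<bullet> (D *v y)"
      using pos_semidef_Cauchy_Schwarz[OF assms(1), of y w] pos by (simp add: divide_le_eq)
    finally show ?thesis .
  qed
  ultimately show thesis using that by blast
qed

lemma pos_def_invertible:
  fixes S :: "real^'n^'n"
  assumes "pos_def S"
  shows "invertible S"
proof -
  have "S *v x = 0 \<Longrightarrow> x = 0" for x
    using assms unfolding pos_def_def by (metis inner_zero_right less_irrefl)
  then show ?thesis
    unfolding invertible_left_inverse using matrix_left_invertible_ker[of S] by blast
qed

lemma matrix_inv_mult:
  fixes A :: "real^'n^'n"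
  assumes "invertible A"
  shows "A ** matrix_inv A = mat 1" and "matrix_inv A ** A = mat 1"
proof -
  have "\<exists>B. A ** B = mat 1 \<and> B ** A = mat 1"
    using assms unfolding invertible_def by blast
  then have "A ** matrix_inv A = mat 1 \<and> matrix_inv A ** A = mat 1"
    unfolding matrix_inv_def by (rule someI_ex)
  then show "A ** matrix_inv A = mat 1" and "matrix_inv A ** A = mat 1"
    by auto
qed

lemma matrix_inv_symmetric:
  fixes S :: "real^'n^'n"
  assumes "symmetric_mat S" and "invertible S"
  shows "symmetric_mat (matrix_inv S)"
proof -
  have "transpose (matrix_inv S) ** S = mat 1"
    using arg_cong[OF matrix_inv_mult(1)[OF assms(2)], of transpose] assms(1)
    unfolding symmetric_mat_def by (simp add: matrix_transpose_mul)
  then have "transpose (matrix_inv S) ** (S ** matrix_inv S) = matrix_inv S"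
    by (simp add: matrix_mul_assoc)
  then show ?thesis
    unfolding symmetric_mat_def by (simp add: matrix_inv_mult(1)[OF assms(2)])
qed

section \<open>The largest eigenvalue as a bound on the quadratic form\<close>

text \<open>Eigenvectors of distinct eigenvalues are orthogonal, and a Euclidean space holds only
  finitely many nonzero pairwise orthogonal directions.\<close>

lemma finite_eigenvalues:
  fixes M :: "real^'n^'n"
  assumes "symmetric_mat M"
  shows "finite {c. eigenvalue_of M c}"
proof -
  define ev where "ev c = (SOME v. v \<noteq> 0 \<and> M *v v = c *\<^sub>R v)" for c
  have ev: "ev c \<noteq> 0" "M *v ev c = c *\<^sub>R ev c" if "eigenvalue_of M c" for c
    using someI_ex[of "\<lambda>v. v \<noteq> 0 \<and> M *v v = c *\<^sub>R v"] that
    unfolding eigenvalue_of_def ev_def by auto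
  have orth: "ev c \<bullet> ev e = 0" if "eigenvalue_of M c" "eigenvalue_of M e" "c \<noteq> e" for c e
    using inner_symmetric_mat_commute[OF assms, of "ev c" "ev e"] ev[OF that(1)] ev[OF that(2)] that(3)
    by (simp add: inner_commute)
  have "pairwise orthogonal (ev ` {c. eigenvalue_of M c})"
    unfolding pairwise_def orthogonal_def using orth by auto
  then have "finite (ev ` {c. eigenvalue_of M c})"
    by (rule pairwise_orthogonal_imp_finite)
  moreover have "inj_on ev {c. eigenvalue_of M c}"
  proof (rule inj_onI)
    fix c e assume ce: "c \<in> {c. eigenvalue_of M c}" "e \<in> {c. eigenvalue_of M c}" "ev c = ev e"
    then have "c *\<^sub>R ev c = e *\<^sub>R ev c"
      using ev(2)[of c] ev(2)[of e] by auto
    moreover have "ev c \<noteq> 0"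
      using ev(1) ce(1) by blast
    ultimately show "c = e"
      by simp
  qed
  ultimately show ?thesis
    using finite_imageD by blast
qed

text \<open>A minimiser \<open>w\<close> of the form of \<open>- M\<close> on the unit sphere makes \<open>(w\<^sup>T M w) I - M\<close> positive
  semidefinite with \<open>w\<close> isotropic, hence \<open>w\<close> is an eigenvector.\<close>

lemma max_Rayleigh_quotient_eigenvalue:
  fixes M :: "real^'n^'n"
  assumes "symmetric_mat M"
  obtains c where "eigenvalue_of M c" and "\<And>v. v \<bullet> (M *v v) \<le> c * (norm v)\<^sup>2"
proof -
  obtain w where w: "norm w = 1" "\<And>v. (w \<bullet> ((- M) *v w)) * (norm v)\<^sup>2 \<le> v \<bullet> ((- M) *v v)"
    using quadratic_form_on_sphere_attains_inf[of "- M"] by blast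
  have neg: "(- M) *v v = - (M *v v)" for v
    using matrix_vector_mult_diff_rdistrib[of 0 M v] by simp
  define c where "c = w \<bullet> (M *v w)"
  have bound: "v \<bullet> (M *v v) \<le> c * (norm v)\<^sup>2" for v
    using w(2)[of v] unfolding c_def neg by simp
  define N where "N = c *\<^sub>R mat 1 - M"
  have N: "N *v v = c *\<^sub>R v - M *v v" for v
    unfolding N_def
    by (simp add: matrix_vector_mult_diff_rdistrib scaleR_matrix_vector_assoc[symmetric])
  have "symmetric_mat N"
    using assms unfolding symmetric_mat_def N_def
    by (simp add: vec_eq_iff transpose_def mat_def)
  then have "pos_semidef N"
    using bound unfolding pos_semidef_def N
    by (simp add: inner_diff_right power2_norm_eq_inner)
  moreover have "w \<bullet> (N *v w) = 0"
    using w(1) unfolding N c_def by (simp add: inner_diff_right flip: power2_norm_eq_inner)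
  ultimately have "N *v w = 0"
    by (rule pos_semidef_isotropic_imp_kernel)
  then have "eigenvalue_of M c"
    unfolding eigenvalue_of_def N using w(1) by (intro exI[of _ w]) auto
  then show thesis
    using that bound by blast
qed

text \<open>This turns the eigenvalue bounds into families of linear inequalities in the matrix, from
  which convexity and monotonicity can be read off.\<close>

lemma lambda_max_le_iff:
  fixes M :: "real^'n^'n"
  assumes "symmetric_mat M"
  shows "lambda_max M \<le> c \<longleftrightarrow> (\<forall>v. v \<bullet> (M *v v) \<le> c * (norm v)\<^sup>2)"
proof -
  obtain e where e: "eigenvalue_of M e" "\<And>v. v \<bullet> (M *v v) \<le> e * (norm v)\<^sup>2"
    using max_Rayleigh_quotient_eigenvalue[OF assms] by blast
  have eig_le: "f \<le> b" if f: "eigenvalue_of M f" and b: "\<forall>v. v \<bullet> (M *v v) \<le> b * (norm v)\<^sup>2" for f b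
  proof -
    obtain u where u: "u \<noteq> 0" "M *v u = f *\<^sub>R u"
      using f unfolding eigenvalue_of_def by blast
    have "f * (norm u)\<^sup>2 \<le> b * (norm u)\<^sup>2"
      using b[rule_format, of u] u(2) by (simp add: power2_norm_eq_inner)
    then show ?thesis
      using u(1) by simp
  qed
  have "lambda_max M = e"
    unfolding lambda_max_def
  proof (rule Max_eqI)
    show "finite {c. eigenvalue_of M c}"
      by (rule finite_eigenvalues[OF assms])
  next
    fix f assume "f \<in> {c. eigenvalue_of M c}"
    then show "f \<le> e"
      using eig_le e(2) by blast
  next
    show "e \<in> {c. eigenvalue_of M c}"
      using e(1) by simp
  qed
  moreover have "v \<bullet> (M *v v) \<le> c * (norm v)\<^sup>2" if "e \<le> c" for v
    using e(2)[of v] mult_right_mono[OF that, of "(norm v)\<^sup>2"] by simp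
  ultimately show ?thesis
    using eig_le[OF e(1)] by blast
qed

section \<open>Block matrices and rank-one matrices\<close>

definition join_vec :: "real^'u \<Rightarrow> real^'x \<Rightarrow> real^('u + 'x)" where
  "join_vec y x = (\<chi> i. case i of Inl a \<Rightarrow> y $ a | Inr b \<Rightarrow> x $ b)"

lemma join_vec_cases:
  fixes w :: "real^('u::finite + 'x::finite)"
  obtains y x where "w = join_vec y x"
proof
  show "w = join_vec (\<chi> a. w $ Inl a) (\<chi> b. w $ Inr b)"
    by (simp add: vec_eq_iff join_vec_def split: sum.split)
qed

lemma sum_UNIV_Plus:
  fixes f :: "'u::finite + 'x::finite \<Rightarrow> 'a::comm_monoid_add"
  shows "(\<Sum>i\<in>UNIV. f i) = (\<Sum>a\<in>UNIV. f (Inl a)) + (\<Sum>b\<in>UNIV. f (Inr b))"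
  using sum.Plus[of UNIV UNIV f] by (simp add: UNIV_Plus_UNIV)

lemma inner_join_vec:
  "join_vec y x \<bullet> join_vec y' x' = y \<bullet> y' + (x :: real^'x::finite) \<bullet> (x' :: real^'x)"
  for y y' :: "real^'u::finite"
  by (simp add: inner_vec_def join_vec_def sum_UNIV_Plus)

lemma block_mat_mult_join_vec:
  fixes Y :: "real^'u::finite^'u" and S :: "real^'x::finite^'x"
  shows "block_mat Y L L' S *v join_vec y x = join_vec (Y *v y + L *v x) (L' *v y + S *v x)"
  by (simp add: vec_eq_iff join_vec_def block_mat_def matrix_vector_mult_def sum_UNIV_Plus
      split: sum.split)

lemma block_quadratic_form:
  fixes Y :: "real^'u::finite^'u" and S :: "real^'x::finite^'x"
  shows "join_vec y x \<bullet> (block_mat Y L (transpose L) S *v join_vec y x)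
    = y \<bullet> (Y *v y) + 2 * (y \<bullet> (L *v x)) + x \<bullet> (S *v x)"
proof -
  have "x \<bullet> (transpose L *v y) = y \<bullet> (L *v x)"
    using dot_lmul_matrix[of y L x] by (simp add: inner_commute)
  then show ?thesis
    by (simp add: block_mat_mult_join_vec inner_join_vec inner_add_right del: transpose_matrix_vector)
qed

lemma block_mat_symmetric:
  fixes Y :: "real^'u::finite^'u" and S :: "real^'x::finite^'x"
  assumes "symmetric_mat Y" and "symmetric_mat S"
  shows "symmetric_mat (block_mat Y L (transpose L) S)"
  using assms unfolding symmetric_mat_def
  by (simp add: vec_eq_iff transpose_def block_mat_def split: sum.split)

text \<open>Completing the square in \<open>x\<close>. The last term vanishes for \<open>x = - S\<^sup>-\<^sup>1 L\<^sup>T y\<close>, so the Schur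
  complement inherits positivity from the block matrix; for positive definite \<open>S\<close> that term is
  nonnegative, so whatever the Schur complement dominates is dominated by the block form.\<close>

lemma Schur_complement_quadratic_form:
  fixes Y :: "real^'u::finite^'u" and S :: "real^'x::finite^'x" and L :: "real^'x^'u"
  assumes "symmetric_mat S" and "invertible S"
  defines "K \<equiv> matrix_inv S ** transpose L"
  shows "join_vec y x \<bullet> (block_mat Y L (transpose L) S *v join_vec y x)
    = y \<bullet> ((Y - L ** matrix_inv S ** transpose L) *v y) + (x + K *v y) \<bullet> (S *v (x + K *v y))"
proof -
  have SK: "S *v (K *v y) = transpose L *v y"
    unfolding K_def
    by (simp add: matrix_vector_mul_assoc matrix_mul_assoc matrix_inv_mult[OF assms(2)]
        del: transpose_matrix_vector)
  have tr: "u \<bullet> (transpose L *v y) = y \<bullet> (L *v u)" for u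
    using dot_lmul_matrix[of y L u] by (simp add: inner_commute)
  have "(x + K *v y) \<bullet> (S *v (x + K *v y))
      = x \<bullet> (S *v x) + 2 * ((K *v y) \<bullet> (S *v x)) + (K *v y) \<bullet> (S *v (K *v y))"
    using quadratic_form_add_scaleR[OF assms(1), of x 1 "K *v y"] by simp
  also have "(K *v y) \<bullet> (S *v x) = x \<bullet> (S *v (K *v y))"
    by (rule inner_symmetric_mat_commute[OF assms(1)])
  finally have "(x + K *v y) \<bullet> (S *v (x + K *v y))
      = x \<bullet> (S *v x) + 2 * (y \<bullet> (L *v x)) + y \<bullet> (L *v (K *v y))"
    unfolding SK tr .
  moreover have "L *v (K *v y) = (L ** matrix_inv S ** transpose L) *v y"
    unfolding K_def
    by (simp only: matrix_vector_mul_assoc matrix_mul_assoc)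
  ultimately show ?thesis
    by (simp add: block_quadratic_form matrix_vector_mult_diff_rdistrib inner_diff_right)
qed

lemma Schur_complement_pos_semidef:
  fixes Y :: "real^'u::finite^'u" and S :: "real^'x::finite^'x"
  assumes "pos_semidef (block_mat Y L (transpose L) S)" and "symmetric_mat Y" and "pos_def S"
  shows "pos_semidef (Y - L ** matrix_inv S ** transpose L)"
proof -
  have S: "symmetric_mat S" "invertible S"
    using assms(3) pos_def_invertible unfolding pos_def_def by auto
  have "transpose (L ** matrix_inv S ** transpose L) = L ** matrix_inv S ** transpose L"
    using matrix_inv_symmetric[OF S] unfolding symmetric_mat_def
    by (simp add: matrix_transpose_mul matrix_mul_assoc)
  then have "symmetric_mat (Y - L ** matrix_inv S ** transpose L)"
    using assms(2) unfolding symmetric_mat_def by (simp add: vec_eq_iff transpose_def)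
  moreover have "0 \<le> y \<bullet> ((Y - L ** matrix_inv S ** transpose L) *v y)" for y
  proof -
    define x where "x = - ((matrix_inv S ** transpose L) *v y)"
    have "0 \<le> join_vec y x \<bullet> (block_mat Y L (transpose L) S *v join_vec y x)"
      using assms(1) unfolding pos_semidef_def by blast
    then show ?thesis
      unfolding Schur_complement_quadratic_form[OF S] x_def by simp
  qed
  ultimately show ?thesis
    unfolding pos_semidef_def by blast
qed

lemma nonzero_Schur_complement_dominates_rank_one:
  fixes Y :: "real^'u::finite^'u" and S :: "real^'x::finite^'x"
  assumes "pos_semidef (block_mat Y L (transpose L) S)" and "symmetric_mat Y" and "pos_def S"
    and "Y \<noteq> L ** matrix_inv S ** transpose L"
  obtains p where "p \<noteq> 0"
    and "\<And>y x. (p \<bullet> y)\<^sup>2 \<le> join_vec y x \<bullet> (block_mat Y L (transpose L) S *v join_vec y x)"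
proof -
  have S: "symmetric_mat S" "invertible S"
    using assms(3) pos_def_invertible unfolding pos_def_def by auto
  obtain p where p: "p \<noteq> 0" "\<And>y. (p \<bullet> y)\<^sup>2 \<le> y \<bullet> ((Y - L ** matrix_inv S ** transpose L) *v y)"
    using nonzero_pos_semidef_dominates_rank_one[OF Schur_complement_pos_semidef[OF assms(1-3)]]
      assms(4) by auto
  have "0 \<le> z \<bullet> (S *v z)" for z
    using assms(3) unfolding pos_def_def by (cases "z = 0") (auto intro: less_imp_le)
  then have "(p \<bullet> y)\<^sup>2 \<le> join_vec y x \<bullet> (block_mat Y L (transpose L) S *v join_vec y x)" for y x
    unfolding Schur_complement_quadratic_form[OF S] using p(2)[of y] by (simp add: add_increasing2)
  then show thesis
    using that p(1) by blast
qed

lemma outer_prod_mult_vec: "outer_prod a b *v z = (b \<bullet> z) *\<^sub>R a"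
  by (simp add: vec_eq_iff outer_prod_def matrix_vector_mult_def inner_vec_def sum_distrib_left
      sum_distrib_right mult_ac)

lemma matrix_mult_outer_prod: "M ** outer_prod a b = outer_prod (M *v a) b"
  by (simp add: vec_eq_iff outer_prod_def matrix_vector_mult_def matrix_matrix_mult_def
      sum_distrib_left mult_ac)

lemma outer_prod_mult_transpose: "outer_prod a b ** transpose M = outer_prod a (M *v b)"
  by (simp add: vec_eq_iff outer_prod_def matrix_vector_mult_def matrix_matrix_mult_def
      transpose_def sum_distrib_left mult_ac)

lemma transpose_outer_prod: "transpose (outer_prod a b) = outer_prod b a"
  by (simp add: vec_eq_iff outer_prod_def transpose_def mult_ac)

lemma trace_outer_prod_mult: "trace (outer_prod a b ** M) = b \<bullet> (M *v a)"
proof -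
  have "trace (outer_prod a b ** M) = (\<Sum>i\<in>UNIV. \<Sum>k\<in>UNIV. a $ i * b $ k * M $ k $ i)"
    by (simp add: trace_def matrix_matrix_mult_def outer_prod_def)
  also have "\<dots> = (\<Sum>k\<in>UNIV. \<Sum>i\<in>UNIV. a $ i * b $ k * M $ k $ i)"
    by (rule sum.swap)
  also have "\<dots> = b \<bullet> (M *v a)"
    by (simp add: inner_vec_def matrix_vector_mult_def sum_distrib_left mult_ac)
  finally show ?thesis .
qed

lemma matrix_add_rdistrib:
  fixes A B :: "real^'n^'m"
  shows "(A + B) ** C = A ** C + B ** C"
  by (simp add: vec_eq_iff matrix_matrix_mult_def sum.distrib algebra_simps)

lemma matrix_mult_scaleR_right:
  fixes A :: "real^'n^'m"
  shows "A ** (c *\<^sub>R B) = c *\<^sub>R (A ** B)"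
  by (simp add: matrix_scalar_ac scalar_matrix_assoc)

lemma transpose_add: "transpose (A + B) = transpose A + transpose (B :: real^'n^'m)"
  by (simp add: vec_eq_iff transpose_def)

lemma trace_linear_combination:
  "trace ((a *\<^sub>R X + b *\<^sub>R Y) ** M) = a * trace (X ** M) + b * trace (Y ** M)"
  for X Y M :: "real^'n^'n"
  by (simp add: matrix_add_rdistrib scalar_matrix_assoc[symmetric] trace_def sum.distrib sum_distrib_left)

lemma quadratic_form_linear_combination:
  "v \<bullet> ((a *\<^sub>R X + b *\<^sub>R Y) *v v) = a * (v \<bullet> (X *v v)) + b * (v \<bullet> (Y *v v))"
  for X Y :: "real^'n^'n"
  by (simp add: matrix_vector_mult_add_rdistrib scaleR_matrix_vector_assoc[symmetric] inner_add_right)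

lemma symmetric_mat_linear_combination:
  assumes "symmetric_mat X" and "symmetric_mat Y"
  shows "symmetric_mat (a *\<^sub>R X + b *\<^sub>R Y)"
  using assms unfolding symmetric_mat_def by (simp add: transpose_add transpose_scalar)

section \<open>Convexity of the feasible set and of the objective\<close>

lemma scaled_lambda_max_le_iff:
  fixes M :: "real^'n^'n"
  assumes "symmetric_mat M" and "0 < c"
  shows "c * lambda_max M - r \<le> s \<longleftrightarrow> (\<forall>z. c * (z \<bullet> (M *v z)) \<le> (r + s) * (norm z)\<^sup>2)"
proof -
  have "c * lambda_max M - r \<le> s \<longleftrightarrow> lambda_max M \<le> (r + s) / c"
    using assms(2) by (simp add: field_simps)
  also have "\<dots> \<longleftrightarrow> (\<forall>z. z \<bullet> (M *v z) \<le> (r + s) / c * (norm z)\<^sup>2)"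
    by (rule lambda_max_le_iff[OF assms(1)])
  also have "\<dots> \<longleftrightarrow> (\<forall>z. c * (z \<bullet> (M *v z)) \<le> (r + s) * (norm z)\<^sup>2)"
    using assms(2) by (simp add: field_simps)
  finally show ?thesis .
qed

lemma scaled_lambda_max_convex:
  fixes X Y :: "real^'n^'n"
  assumes "symmetric_mat X" and "symmetric_mat Y" and "0 < c" and "0 \<le> \<theta>" and "\<theta> \<le> 1"
    and "c * lambda_max X - r \<le> s" and "c * lambda_max Y - r \<le> t"
  shows "c * lambda_max ((1 - \<theta>) *\<^sub>R X + \<theta> *\<^sub>R Y) - r \<le> (1 - \<theta>) * s + \<theta> * t"
proof -
  have "c * (z \<bullet> (((1 - \<theta>) *\<^sub>R X + \<theta> *\<^sub>R Y) *v z))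
      \<le> (r + ((1 - \<theta>) * s + \<theta> * t)) * (norm z)\<^sup>2" for z
  proof -
    have "(1 - \<theta>) * (c * (z \<bullet> (X *v z))) + \<theta> * (c * (z \<bullet> (Y *v z)))
        \<le> (1 - \<theta>) * ((r + s) * (norm z)\<^sup>2) + \<theta> * ((r + t) * (norm z)\<^sup>2)"
      using assms by (intro add_mono mult_left_mono) (auto simp: scaled_lambda_max_le_iff)
    then show ?thesis
      unfolding quadratic_form_linear_combination by (simp add: algebra_simps)
  qed
  then show ?thesis
    by (simp add: scaled_lambda_max_le_iff symmetric_mat_linear_combination assms)
qed

definition decision_mix ::
  "real \<Rightarrow> ('x::finite, 'u::finite, 's::finite) decision \<Rightarrow> ('x, 'u, 's) decision
    \<Rightarrow> ('x, 'u, 's) decision" where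
  "decision_mix \<theta> v w = \<lparr>
     varS = (\<lambda>k i. (1 - \<theta>) *\<^sub>R varS v k i + \<theta> *\<^sub>R varS w k i),
     varSigma = (\<lambda>k. (1 - \<theta>) *\<^sub>R varSigma v k + \<theta> *\<^sub>R varSigma w k),
     varL = (\<lambda>k i. (1 - \<theta>) *\<^sub>R varL v k i + \<theta> *\<^sub>R varL w k i),
     varY = (\<lambda>k i. (1 - \<theta>) *\<^sub>R varY v k i + \<theta> *\<^sub>R varY w k i),
     slack = (\<lambda>m k. (1 - \<theta>) * slack v m k + \<theta> * slack w m k)\<rparr>"

lemma decision_mix_simps [simp]:
  "varS (decision_mix \<theta> v w) k i = (1 - \<theta>) *\<^sub>R varS v k i + \<theta> *\<^sub>R varS w k i"
  "varSigma (decision_mix \<theta> v w) k = (1 - \<theta>) *\<^sub>R varSigma v k + \<theta> *\<^sub>R varSigma w k"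
  "varL (decision_mix \<theta> v w) k i = (1 - \<theta>) *\<^sub>R varL v k i + \<theta> *\<^sub>R varL w k i"
  "varY (decision_mix \<theta> v w) k i = (1 - \<theta>) *\<^sub>R varY v k i + \<theta> *\<^sub>R varY w k i"
  "slack (decision_mix \<theta> v w) m k = (1 - \<theta>) * slack v m k + \<theta> * slack w m k"
  by (simp_all add: decision_mix_def)

text \<open>The contribution of mode \<open>i\<close> to the recursion for \<open>S\<close>, before weighting by the transition
  probability. It is affine in \<open>(S, L, Y)\<close>, and the recursion depends on \<open>L\<close> and \<open>Y\<close> only through it.\<close>

definition successor_moment ::
  "('x::finite, 'u::finite, 'w::finite, 's::finite) mjls_data \<Rightarrow> ('x, 'u, 's) decision
    \<Rightarrow> nat \<Rightarrow> 's \<Rightarrow> real^'x^'x" where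
  "successor_moment d v k i =
     dynA d k i ** varS v k i ** transpose (dynA d k i)
     + dynA d k i ** transpose (varL v k i) ** transpose (dynB d k i)
     + dynB d k i ** varL v k i ** transpose (dynA d k i)
     + dynB d k i ** varY v k i ** transpose (dynB d k i)
     + (rho d k $ i) *\<^sub>R outer_prod (m_vec d k i) (m_vec d k i)
     + (rho d k $ i) *\<^sub>R (dynG d k i ** transpose (dynG d k i))"

lemma successor_moment_decision_mix:
  fixes d :: "('x::finite, 'u::finite, 'w::finite, 's::finite) mjls_data"
    and v w :: "('x, 'u, 's) decision"
  shows "successor_moment d (decision_mix \<theta> v w) k i
    = (1 - \<theta>) *\<^sub>R successor_moment d v k i + \<theta> *\<^sub>R successor_moment d w k i"
proof -
  have affine: "(1 - \<theta>) *\<^sub>R X + \<theta> *\<^sub>R X = X" for X :: "real^'x^'x"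
    by (simp flip: scaleR_left_distrib)
  have linear: "M ** ((1 - \<theta>) *\<^sub>R X + \<theta> *\<^sub>R Y) ** N = (1 - \<theta>) *\<^sub>R (M ** X ** N) + \<theta> *\<^sub>R (M ** Y ** N)"
    for M :: "real^'b^'a" and X Y :: "real^'c^'b" and N :: "real^'e^'c"
    by (simp add: matrix_add_ldistrib matrix_add_rdistrib matrix_mult_scaleR_right scalar_matrix_assoc[symmetric])
  define c where "c = (rho d k $ i) *\<^sub>R outer_prod (m_vec d k i) (m_vec d k i)
     + (rho d k $ i) *\<^sub>R (dynG d k i ** transpose (dynG d k i))"
  have split: "successor_moment d u k i = dynA d k i ** varS u k i ** transpose (dynA d k i)
     + dynA d k i ** transpose (varL u k i) ** transpose (dynB d k i)
     + dynB d k i ** varL u k i ** transpose (dynA d k i)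
     + dynB d k i ** varY u k i ** transpose (dynB d k i) + c" for u :: "('x, 'u, 's) decision"
    by (simp add: successor_moment_def c_def add.assoc)
  have "successor_moment d (decision_mix \<theta> v w) k i
      = (1 - \<theta>) *\<^sub>R (successor_moment d v k i - c) + \<theta> *\<^sub>R (successor_moment d w k i - c) + c"
    unfolding split
    by (simp add: transpose_add transpose_scalar linear scaleR_add_right)
  then show ?thesis
    using affine[of c] by (simp add: scaleR_diff_right algebra_simps)
qed

lemma equality_constraints_decision_mix:
  fixes d :: "('x::finite, 'u::finite, 'w::finite, 's::finite) mjls_data"
    and v w :: "('x, 'u, 's) decision"
  assumes "equality_constraints d v" and "equality_constraints d w"
  shows "equality_constraints d (decision_mix \<theta> v w)"
proof -
  have affine: "(1 - \<theta>) *\<^sub>R X + \<theta> *\<^sub>R X = X" for X :: "real^'x^'x"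
    by (simp flip: scaleR_left_distrib)
  have comb: "(1 - \<theta>) *\<^sub>R (X - Z) + \<theta> *\<^sub>R (Y - Z) = ((1 - \<theta>) *\<^sub>R X + \<theta> *\<^sub>R Y) - Z"
    for X Y Z :: "real^'x^'x"
    using affine[of Z] by (simp add: scaleR_diff_right algebra_simps)
  note eqs = assms[unfolded equality_constraints_def, folded successor_moment_def]
  have "varS (decision_mix \<theta> v w) (Suc k) l =
        (\<Sum>i\<in>UNIV. (trans_mat d $ i $ l) *\<^sub>R successor_moment d (decision_mix \<theta> v w) k i)
        - (rho d (Suc k) $ l) *\<^sub>R outer_prod (xbar d (Suc k) l) (xbar d (Suc k) l)"
    if "k < horizon d" for k l
  proof -
    have "(\<Sum>i\<in>UNIV. (trans_mat d $ i $ l) *\<^sub>R successor_moment d (decision_mix \<theta> v w) k i)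
        = (1 - \<theta>) *\<^sub>R (\<Sum>i\<in>UNIV. (trans_mat d $ i $ l) *\<^sub>R successor_moment d v k i)
          + \<theta> *\<^sub>R (\<Sum>i\<in>UNIV. (trans_mat d $ i $ l) *\<^sub>R successor_moment d w k i)"
      by (simp add: successor_moment_decision_mix scaleR_add_right sum.distrib scaleR_sum_right
          mult.commute)
    then show ?thesis
      using eqs that comb by simp
  qed
  moreover have "varS (decision_mix \<theta> v w) 0 i = (rho d 0 $ i) *\<^sub>R Sigma_init d" for i
  proof -
    have "varS v 0 i = (rho d 0 $ i) *\<^sub>R Sigma_init d" "varS w 0 i = (rho d 0 $ i) *\<^sub>R Sigma_init d"
      using eqs by blast+
    then show ?thesis
      by (simp only: decision_mix_simps affine)
  qed
  moreover have "varSigma (decision_mix \<theta> v w) k = (\<Sum>i\<in>UNIV. varS (decision_mix \<theta> v w) k i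
           + (rho d k $ i) *\<^sub>R outer_prod (xbar d k i - mu d k) (xbar d k i - mu d k))"
    if "k \<le> horizon d" for k
  proof -
    define Z where "Z = (\<Sum>i\<in>UNIV. (rho d k $ i) *\<^sub>R outer_prod (xbar d k i - mu d k) (xbar d k i - mu d k))"
    have "varSigma v k = (\<Sum>i\<in>UNIV. varS v k i) + Z" "varSigma w k = (\<Sum>i\<in>UNIV. varS w k i) + Z"
      using eqs that unfolding Z_def by (auto simp: sum.distrib)
    then have "varSigma (decision_mix \<theta> v w) k
        = ((1 - \<theta>) *\<^sub>R (\<Sum>i\<in>UNIV. varS v k i) + \<theta> *\<^sub>R (\<Sum>i\<in>UNIV. varS w k i)) + Z"
      using affine[of Z] by (simp add: scaleR_add_right)
    then show ?thesis
      unfolding Z_def by (simp add: sum.distrib scaleR_sum_right)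
  qed
  ultimately show ?thesis
    unfolding equality_constraints_def successor_moment_def by blast
qed

text \<open>The block inequality is separated from the other constraints because the step constructed
  below preserves all of them except this one.\<close>

definition feasible_up_to_LMI ::
  "('x::finite, 'u::finite, 'w::finite, 's::finite) mjls_data \<Rightarrow> ('x, 'u, 's) decision \<Rightarrow> bool" where
  "feasible_up_to_LMI d v \<longleftrightarrow>
     symmetric_vars d v \<and> equality_constraints d v \<and>
     pos_semidef (Sigma_fin d - varSigma v (horizon d)) \<and>
     (\<forall>k<horizon d. \<forall>j<num_xhs d. state_hs_lhs d v k j \<le> slack v 1 k) \<and>
     (\<forall>k<horizon d. \<forall>i. \<forall>j<num_uhs d. control_hs_lhs d v k i j \<le> slack v 2 k) \<and>
     (\<forall>k<horizon d. state_norm_lhs d v k \<le> slack v 3 k) \<and>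
     (\<forall>k<horizon d. \<forall>i. control_norm_lhs d v k i \<le> slack v 4 k) \<and>
     (\<forall>m\<in>{1..4}. \<forall>k<horizon d. 0 \<le> slack v m k)"

abbreviation LMI_block ::
  "('x::finite, 'u::finite, 's::finite) decision \<Rightarrow> nat \<Rightarrow> 's \<Rightarrow> real^('u + 'x)^('u + 'x)" where
  "LMI_block v k i \<equiv> block_mat (varY v k i) (varL v k i) (transpose (varL v k i)) (varS v k i)"

lemma feasible_iff_LMI:
  "feasible d v \<longleftrightarrow> feasible_up_to_LMI d v \<and> (\<forall>k<horizon d. \<forall>i. pos_semidef (LMI_block v k i))"
  unfolding feasible_def feasible_up_to_LMI_def by blast

lemma pos_def_imp_pos_semidef: "pos_def M \<Longrightarrow> pos_semidef M"
  unfolding pos_def_def pos_semidef_def by (metis inner_zero_left less_imp_le order_refl)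

lemma slater_point_feasible_up_to_LMI:
  assumes "slater_point d v"
  shows "feasible_up_to_LMI d v"
  using assms unfolding slater_point_def feasible_up_to_LMI_def
  by (auto intro: pos_def_imp_pos_semidef less_imp_le)

text \<open>Half-space constraints and the recursion are affine in the variables, and \<open>\<lambda>\<^sub>m\<^sub>a\<^sub>x\<close> is a supremum
  of linear functions of the matrix.\<close>

lemma feasible_up_to_LMI_decision_mix:
  fixes d :: "('x::finite, 'u::finite, 'w::finite, 's::finite) mjls_data"
    and v w :: "('x, 'u, 's) decision"
  assumes data: "valid_data d" and \<theta>: "0 \<le> \<theta>" "\<theta> \<le> 1"
    and v: "feasible_up_to_LMI d v" and w: "feasible_up_to_LMI d w"
  shows "feasible_up_to_LMI d (decision_mix \<theta> v w)"
proof -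
  have avg: "(1 - \<theta>) * a + \<theta> * b \<le> (1 - \<theta>) * s + \<theta> * t" if "a \<le> s" "b \<le> t" for a b s t :: real
    using \<theta> that by (intro add_mono mult_left_mono) auto
  note v' = v[unfolded feasible_up_to_LMI_def] and w' = w[unfolded feasible_up_to_LMI_def]
  have sym: "symmetric_vars d (decision_mix \<theta> v w)"
    using v' w' unfolding symmetric_vars_def by (simp add: symmetric_mat_linear_combination)
  have eq: "equality_constraints d (decision_mix \<theta> v w)"
    using v' w' by (intro equality_constraints_decision_mix) auto
  have fin: "pos_semidef (Sigma_fin d - varSigma (decision_mix \<theta> v w) (horizon d))"
  proof -
    define X Y where "X = Sigma_fin d - varSigma v (horizon d)"
      and "Y = Sigma_fin d - varSigma w (horizon d)"
    have "Sigma_fin d - varSigma (decision_mix \<theta> v w) (horizon d) = (1 - \<theta>) *\<^sub>R X + \<theta> *\<^sub>R Y"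
      unfolding X_def Y_def by (simp add: algebra_simps)
    moreover have "pos_semidef X" "pos_semidef Y"
      using v' w' unfolding X_def Y_def by auto
    ultimately show ?thesis
      using \<theta> unfolding pos_semidef_def
      by (simp add: symmetric_mat_linear_combination quadratic_form_linear_combination)
  qed
  have state_hs: "state_hs_lhs d (decision_mix \<theta> v w) k j \<le> slack (decision_mix \<theta> v w) 1 k"
    if "k < horizon d" "j < num_xhs d" for k j
  proof -
    have "state_hs_lhs d (decision_mix \<theta> v w) k j
        = (1 - \<theta>) * state_hs_lhs d v k j + \<theta> * state_hs_lhs d w k j"
      unfolding state_hs_lhs_def decision_mix_simps quadratic_form_linear_combination
      by algebra
    then show ?thesis
      using avg v' w' that by simp
  qed
  have control_hs: "control_hs_lhs d (decision_mix \<theta> v w) k i j \<le> slack (decision_mix \<theta> v w) 2 k"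
    if "k < horizon d" "j < num_uhs d" for k i j
  proof -
    have "control_hs_lhs d (decision_mix \<theta> v w) k i j
        = (1 - \<theta>) * control_hs_lhs d v k i j + \<theta> * control_hs_lhs d w k i j"
      unfolding control_hs_lhs_def decision_mix_simps scaleR_matrix_vector_assoc[symmetric]
        inner_scaleR_right quadratic_form_linear_combination
      by algebra
    then show ?thesis
      using avg v' w' that by simp
  qed
  have state_norm: "state_norm_lhs d (decision_mix \<theta> v w) k \<le> slack (decision_mix \<theta> v w) 3 k"
    if "k < horizon d" for k
    unfolding state_norm_lhs_def decision_mix_simps
  proof (rule scaled_lambda_max_convex)
    show "symmetric_mat (varSigma v k)" "symmetric_mat (varSigma w k)"
      using v' w' that unfolding symmetric_vars_def by auto
    show "0 < real CARD('x) / eps_x d"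
      using data unfolding valid_data_def by simp
  qed (use \<theta> v' w' that in \<open>auto simp: state_norm_lhs_def\<close>)
  have control_norm: "control_norm_lhs d (decision_mix \<theta> v w) k i \<le> slack (decision_mix \<theta> v w) 4 k"
    if "k < horizon d" for k i
  proof -
    have "(1 / rho d k $ i) *\<^sub>R varY (decision_mix \<theta> v w) k i
        = (1 - \<theta>) *\<^sub>R ((1 / rho d k $ i) *\<^sub>R varY v k i) + \<theta> *\<^sub>R ((1 / rho d k $ i) *\<^sub>R varY w k i)"
      by (simp add: scaleR_add_right mult.commute)
    moreover have "real CARD('u) / eps_u d i
          * lambda_max ((1 - \<theta>) *\<^sub>R ((1 / rho d k $ i) *\<^sub>R varY v k i)
            + \<theta> *\<^sub>R ((1 / rho d k $ i) *\<^sub>R varY w k i)) - (u_max d i - norm (ubar d k i))\<^sup>2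
        \<le> (1 - \<theta>) * slack v 4 k + \<theta> * slack w 4 k"
    proof (rule scaled_lambda_max_convex)
      show "symmetric_mat ((1 / rho d k $ i) *\<^sub>R varY v k i)"
        "symmetric_mat ((1 / rho d k $ i) *\<^sub>R varY w k i)"
        using v' w' that unfolding symmetric_vars_def symmetric_mat_def
        by (auto simp: transpose_scalar)
      show "0 < real CARD('u) / eps_u d i"
        using data unfolding valid_data_def by simp
    qed (use \<theta> v' w' that in \<open>auto simp: control_norm_lhs_def\<close>)
    ultimately show ?thesis
      unfolding control_norm_lhs_def by simp
  qed
  have "0 \<le> slack (decision_mix \<theta> v w) m k" if "m \<in> {1..4}" "k < horizon d" for m k
    using \<theta> v' w' that by simp
  then show ?thesis
    unfolding feasible_up_to_LMI_def
    using sym eq fin state_hs control_hs state_norm control_norm by blast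
qed

lemma objective_decision_mix_le:
  fixes d :: "('x::finite, 'u::finite, 'w::finite, 's::finite) mjls_data"
    and v w :: "('x, 'u, 's) decision"
  assumes "valid_data d" and "0 \<le> \<theta>" and "\<theta> \<le> 1"
  shows "objective d (decision_mix \<theta> v w) \<le> (1 - \<theta>) * objective d v + \<theta> * objective d w"
proof -
  define c where "c v = (\<Sum>k<horizon d. \<Sum>i\<in>UNIV. trace (varS v k i ** costQ d k) + trace (varY v k i ** costR d k))"
    for v :: "('x, 'u, 's) decision"
  define s where "s v = (\<Sum>m=1..4. penalty d m * (\<Sum>k<horizon d. \<bar>slack v m k\<bar>))"
    for v :: "('x, 'u, 's) decision"
  have obj: "objective d v = c v + s v" for v
    unfolding objective_def c_def s_def ..
  have "c (decision_mix \<theta> v w) = (1 - \<theta>) * c v + \<theta> * c w"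
    unfolding c_def decision_mix_simps trace_linear_combination
    by (simp add: sum.distrib sum_distrib_left distrib_left)
  moreover have "s (decision_mix \<theta> v w) \<le> (1 - \<theta>) * s v + \<theta> * s w"
  proof -
    have "s (decision_mix \<theta> v w) \<le> (\<Sum>m=1..4. penalty d m *
        (\<Sum>k<horizon d. (1 - \<theta>) * \<bar>slack v m k\<bar> + \<theta> * \<bar>slack w m k\<bar>))"
      unfolding s_def
    proof (intro sum_mono mult_left_mono)
      fix m k :: nat
      show "\<bar>slack (decision_mix \<theta> v w) m k\<bar> \<le> (1 - \<theta>) * \<bar>slack v m k\<bar> + \<theta> * \<bar>slack w m k\<bar>"
        using abs_triangle_ineq[of "(1 - \<theta>) * slack v m k" "\<theta> * slack w m k"] assms
        by (simp add: abs_mult)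
    next
      fix m :: nat assume "m \<in> {1..4}"
      then show "0 \<le> penalty d m"
        using assms(1) unfolding valid_data_def by (auto intro: less_imp_le)
    qed
    also have "\<dots> = (1 - \<theta>) * s v + \<theta> * s w"
      unfolding s_def by (simp add: sum.distrib sum_distrib_left distrib_left mult.left_commute)
    finally show ?thesis .
  qed
  ultimately show ?thesis
    unfolding obj by (simp add: algebra_simps)
qed

section \<open>A cost-decreasing direction that keeps the covariance dynamics\<close>

text \<open>Put \<open>g = A\<^sup>-\<^sup>1 B p\<close> and move \<open>L\<close> by \<open>\<epsilon> p g\<^sup>T\<close>. Then \<open>B L A\<^sup>T\<close> and \<open>A L\<^sup>T B\<^sup>T\<close> both change by
  \<open>\<epsilon> (B p) (B p)\<^sup>T\<close>, because \<open>A g = B p\<close>; moving \<open>Y\<close> by \<open>- 2 \<epsilon> p p\<^sup>T\<close> compensates exactly, so the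
  matrices \<open>S\<close> of all times can stay as they are.\<close>

definition covariance_neutral_step ::
  "('x::finite, 'u::finite, 'w::finite, 's::finite) mjls_data \<Rightarrow> (nat \<Rightarrow> 's \<Rightarrow> real^'u) \<Rightarrow> real
    \<Rightarrow> ('x, 'u, 's) decision \<Rightarrow> ('x, 'u, 's) decision" where
  "covariance_neutral_step d p \<epsilon> v = v\<lparr>
     varL := \<lambda>k i. varL v k i
       + \<epsilon> *\<^sub>R outer_prod (p k i) (matrix_inv (dynA d k i) *v (dynB d k i *v p k i)),
     varY := \<lambda>k i. varY v k i - (2 * \<epsilon>) *\<^sub>R outer_prod (p k i) (p k i)\<rparr>"

lemma covariance_neutral_step_simps [simp]:
  "varS (covariance_neutral_step d p \<epsilon> v) = varS v"
  "varSigma (covariance_neutral_step d p \<epsilon> v) = varSigma v"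
  "slack (covariance_neutral_step d p \<epsilon> v) = slack v"
  "varL (covariance_neutral_step d p \<epsilon> v) k i = varL v k i
     + \<epsilon> *\<^sub>R outer_prod (p k i) (matrix_inv (dynA d k i) *v (dynB d k i *v p k i))"
  "varY (covariance_neutral_step d p \<epsilon> v) k i
    = varY v k i - (2 * \<epsilon>) *\<^sub>R outer_prod (p k i) (p k i)"
  by (simp_all add: covariance_neutral_step_def)

lemma successor_moment_covariance_neutral_step:
  assumes "invertible (dynA d k i)"
  shows "successor_moment d (covariance_neutral_step d p \<epsilon> v) k i = successor_moment d v k i"
proof -
  define A B b where "A = dynA d k i" and "B = dynB d k i" and "b = dynB d k i *v p k i"
  have inv: "A *v (matrix_inv A *v b) = b"
    using matrix_inv_mult(1)[OF assms] unfolding A_def by (simp add: matrix_vector_mul_assoc)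
  have "A ** transpose (varL v k i + \<epsilon> *\<^sub>R outer_prod (p k i) (matrix_inv A *v b)) ** transpose B
      = A ** transpose (varL v k i) ** transpose B + \<epsilon> *\<^sub>R outer_prod b b"
    using inv unfolding b_def B_def
    by (simp add: transpose_add transpose_scalar transpose_outer_prod matrix_add_ldistrib
        matrix_add_rdistrib matrix_mult_scaleR_right scalar_matrix_assoc[symmetric] matrix_mult_outer_prod
        outer_prod_mult_transpose)
  moreover have "B ** (varL v k i + \<epsilon> *\<^sub>R outer_prod (p k i) (matrix_inv A *v b)) ** transpose A
      = B ** varL v k i ** transpose A + \<epsilon> *\<^sub>R outer_prod b b"
    using inv unfolding b_def B_def
    by (simp add: matrix_add_ldistrib matrix_add_rdistrib matrix_mult_scaleR_right
        scalar_matrix_assoc[symmetric] matrix_mult_outer_prod outer_prod_mult_transpose)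
  moreover have "B ** (varY v k i - (2 * \<epsilon>) *\<^sub>R outer_prod (p k i) (p k i)) ** transpose B
      = B ** varY v k i ** transpose B - \<epsilon> *\<^sub>R outer_prod b b - \<epsilon> *\<^sub>R outer_prod b b"
  proof -
    have "B ** (varY v k i + (- (2 * \<epsilon>)) *\<^sub>R outer_prod (p k i) (p k i)) ** transpose B
        = B ** varY v k i ** transpose B + (- (2 * \<epsilon>)) *\<^sub>R outer_prod b b"
      unfolding b_def B_def matrix_add_ldistrib matrix_add_rdistrib matrix_mult_scaleR_right
        scalar_matrix_assoc[symmetric] matrix_mult_outer_prod outer_prod_mult_transpose ..
    moreover have "(- (2 * \<epsilon>)) *\<^sub>R outer_prod b b = - \<epsilon> *\<^sub>R outer_prod b b - \<epsilon> *\<^sub>R outer_prod b b"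
      by (simp only: scaleR_left_diff_distrib[symmetric]) simp
    ultimately show ?thesis by simp
  qed
  ultimately show ?thesis
    unfolding successor_moment_def covariance_neutral_step_simps A_def B_def b_def
    by (simp add: algebra_simps)
qed

text \<open>The step only shrinks \<open>Y\<close>, which relaxes every control constraint, and it leaves \<open>S\<close>, \<open>\<Sigma>\<close> and
  the slacks untouched.\<close>

lemma feasible_up_to_LMI_covariance_neutral_step:
  fixes d :: "('x::finite, 'u::finite, 'w::finite, 's::finite) mjls_data"
    and v :: "('x, 'u, 's) decision"
  assumes data: "valid_data d" and rho: "\<forall>k\<le>horizon d. \<forall>i. 0 < rho d k $ i"
    and "0 \<le> \<epsilon>" and v: "feasible_up_to_LMI d v"
  shows "feasible_up_to_LMI d (covariance_neutral_step d p \<epsilon> v)"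
proof -
  let ?w = "covariance_neutral_step d p \<epsilon> v"
  note v' = v[unfolded feasible_up_to_LMI_def]
  have outer_sym: "transpose (outer_prod a a) = outer_prod a a" for a :: "real^'u"
    by (rule transpose_outer_prod)
  have sym: "symmetric_vars d ?w"
  proof -
    have "symmetric_mat (X - (2 * \<epsilon>) *\<^sub>R outer_prod a a)" if "symmetric_mat X"
      for X and a :: "real^'u"
      using that symmetric_mat_linear_combination[of X "outer_prod a a" 1 "- (2 * \<epsilon>)"] outer_sym
      unfolding symmetric_mat_def by simp
    then show ?thesis
      using v' unfolding symmetric_vars_def by simp
  qed
  have eq: "equality_constraints d ?w"
  proof -
    have "\<forall>k<horizon d. \<forall>i. invertible (dynA d k i)"
      using data unfolding valid_data_def by blast
    then have "\<forall>k<horizon d. \<forall>i. successor_moment d ?w k i = successor_moment d v k i"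
      by (simp add: successor_moment_covariance_neutral_step)
    moreover have "equality_constraints d v"
      using v' by blast
    ultimately show ?thesis
      unfolding equality_constraints_def successor_moment_def[symmetric] by simp
  qed
  have Y_le: "z \<bullet> (((1 / rho d k $ i) *\<^sub>R varY ?w k i) *v z) \<le> z \<bullet> (((1 / rho d k $ i) *\<^sub>R varY v k i) *v z)"
    if "k < horizon d" for k i z
  proof -
    have "z \<bullet> (varY ?w k i *v z) = z \<bullet> (varY v k i *v z) - 2 * \<epsilon> * (p k i \<bullet> z)\<^sup>2"
      by (simp add: matrix_vector_mult_diff_rdistrib scaleR_matrix_vector_assoc[symmetric]
          outer_prod_mult_vec inner_diff_right power2_eq_square inner_commute)
    then have "z \<bullet> (varY ?w k i *v z) \<le> z \<bullet> (varY v k i *v z)"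
      using \<open>0 \<le> \<epsilon>\<close> by simp
    moreover have "0 < rho d k $ i"
      using rho that by simp
    ultimately show ?thesis
      by (simp only: scaleR_matrix_vector_assoc[symmetric] inner_scaleR_right mult_left_mono
          zero_le_divide_1_iff less_imp_le)
  qed
  have control_hs: "control_hs_lhs d ?w k i j \<le> slack ?w 2 k"
    if "k < horizon d" "j < num_uhs d" for k i j
  proof -
    have "0 \<le> (1 - delta_uj d j i) / delta_uj d j i"
      using data that unfolding valid_data_def by (simp add: less_imp_le)
    from mult_left_mono[OF Y_le[OF that(1), of "f_vec d j" i] this]
    have "control_hs_lhs d ?w k i j \<le> control_hs_lhs d v k i j"
      unfolding control_hs_lhs_def by simp
    also have "\<dots> \<le> slack ?w 2 k"
      using v' that by simp
    finally show ?thesis .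
  qed
  have control_norm: "control_norm_lhs d ?w k i \<le> slack ?w 4 k" if "k < horizon d" for k i
  proof -
    have pos: "0 < real CARD('u) / eps_u d i"
      using data unfolding valid_data_def by simp
    have "symmetric_mat (varY v k i)" and "symmetric_mat (varY ?w k i)"
      using v' sym that unfolding symmetric_vars_def by blast+
    then have sym': "symmetric_mat ((1 / rho d k $ i) *\<^sub>R varY v k i)"
      "symmetric_mat ((1 / rho d k $ i) *\<^sub>R varY ?w k i)"
      unfolding symmetric_mat_def by (simp_all only: transpose_scalar)
    have "control_norm_lhs d v k i \<le> slack v 4 k"
      using v' that by blast
    then show ?thesis
      unfolding control_norm_lhs_def scaled_lambda_max_le_iff[OF sym'(1) pos]
        scaled_lambda_max_le_iff[OF sym'(2) pos]
      using mult_left_mono[OF Y_le[OF that] less_imp_le[OF pos]]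
      unfolding covariance_neutral_step_simps(3) by (blast intro: order_trans)
  qed
  show ?thesis
    unfolding feasible_up_to_LMI_def
    using v' sym eq control_hs control_norm by (simp add: state_hs_lhs_def state_norm_lhs_def)
qed

lemma objective_covariance_neutral_step:
  "objective d (covariance_neutral_step d p \<epsilon> v)
    = objective d v - 2 * \<epsilon> * (\<Sum>k<horizon d. \<Sum>i\<in>UNIV. p k i \<bullet> (costR d k *v p k i))"
proof -
  have "trace ((varY v k i - (2 * \<epsilon>) *\<^sub>R outer_prod (p k i) (p k i)) ** costR d k)
      = trace (varY v k i ** costR d k) - 2 * \<epsilon> * (p k i \<bullet> (costR d k *v p k i))" for k i
    using trace_linear_combination[of 1 "varY v k i" "- 2 * \<epsilon>" "outer_prod (p k i) (p k i)" "costR d k"]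
    by (simp add: trace_outer_prod_mult)
  then show ?thesis
    unfolding objective_def covariance_neutral_step_simps
    by (simp add: sum.distrib sum_subtractf sum_distrib_left)
qed

text \<open>With \<open>a = p\<^sup>T y\<close> and \<open>b = g\<^sup>T x\<close> the step changes the block form by \<open>- 2 \<epsilon> a\<^sup>2 + 2 \<epsilon> a b\<close>. Since the
  form was at least \<open>a\<^sup>2\<close>, the first-order change is absorbed by completing the square in \<open>a\<close>, and
  only a defect of second order in \<open>\<epsilon>\<close> remains.\<close>

lemma LMI_defect_covariance_neutral_step:
  assumes "0 \<le> \<epsilon>" and "\<epsilon> \<le> 1 / 4"
    and dom: "\<And>y x. (p k i \<bullet> y)\<^sup>2 \<le> join_vec y x \<bullet> (LMI_block v k i *v join_vec y x)"
  shows "- 2 * \<epsilon>\<^sup>2 * (join_vec 0 (matrix_inv (dynA d k i) *v (dynB d k i *v p k i)) \<bullet> z)\<^sup>2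
    \<le> z \<bullet> (LMI_block (covariance_neutral_step d p \<epsilon> v) k i *v z)"
proof -
  obtain y x where z: "z = join_vec y x"
    by (rule join_vec_cases)
  define g where "g = matrix_inv (dynA d k i) *v (dynB d k i *v p k i)"
  define a b where "a = p k i \<bullet> y" and "b = g \<bullet> x"
  have "z \<bullet> (LMI_block (covariance_neutral_step d p \<epsilon> v) k i *v z)
      = z \<bullet> (LMI_block v k i *v z) - 2 * \<epsilon> * a\<^sup>2 + 2 * \<epsilon> * a * b"
    unfolding z block_quadratic_form covariance_neutral_step_simps g_def[symmetric] a_def b_def
    by (simp add: scaleR_matrix_vector_assoc[symmetric] outer_prod_mult_vec power2_eq_square
        inner_commute algebra_simps)
  moreover have "a\<^sup>2 \<le> z \<bullet> (LMI_block v k i *v z)"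
    using dom unfolding a_def z .
  moreover have "- 2 * \<epsilon>\<^sup>2 * b\<^sup>2 \<le> a\<^sup>2 - 2 * \<epsilon> * a\<^sup>2 + 2 * \<epsilon> * a * b"
  proof -
    have "a\<^sup>2 - 2 * \<epsilon> * a\<^sup>2 + 2 * \<epsilon> * a * b + 2 * \<epsilon>\<^sup>2 * b\<^sup>2
        = (1 / 2 - 2 * \<epsilon>) * a\<^sup>2 + (a + 2 * \<epsilon> * b)\<^sup>2 / 2"
      by (simp add: power2_eq_square field_simps)
    also have "\<dots> \<ge> 0"
      using assms(2) by simp
    finally show ?thesis by simp
  qed
  moreover have "join_vec 0 g \<bullet> z = b"
    unfolding z b_def inner_join_vec by simp
  ultimately show ?thesis
    unfolding g_def[symmetric] by simp
qed

section \<open>Optimal solutions admit no cost-decreasing direction\<close>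

lemma block_mat_linear_combination:
  fixes Y Y' :: "real^'u::finite^'u" and S S' :: "real^'x::finite^'x"
  shows "block_mat (a *\<^sub>R Y + b *\<^sub>R Y') (a *\<^sub>R L + b *\<^sub>R L') (transpose (a *\<^sub>R L + b *\<^sub>R L')) (a *\<^sub>R S + b *\<^sub>R S')
    = a *\<^sub>R block_mat Y L (transpose L) S + b *\<^sub>R block_mat Y' L' (transpose L') S'"
  by (simp add: vec_eq_iff block_mat_def transpose_def split: sum.split)

text \<open>Taking the step and then mixing in the Slater point with weight \<open>\<theta> = 2 \<epsilon>\<^sup>2 C\<close> repairs the block
  inequality. The step lowers the objective by an amount linear in \<open>\<epsilon>\<close>, the mixing raises it by at
  most an amount quadratic in \<open>\<epsilon>\<close>, so for small \<open>\<epsilon>\<close> the outcome would beat the optimum.\<close>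

lemma optimal_dominated_direction_eq_0:
  fixes d :: "('x::finite, 'u::finite, 'w::finite, 's::finite) mjls_data"
    and v :: "('x, 'u, 's) decision"
  assumes data: "valid_data d" and rho: "\<forall>k\<le>horizon d. \<forall>i. 0 < rho d k $ i"
    and slater: "slater_condition d" and opt: "optimal_solution d v"
    and dom: "\<And>k i y x. k < horizon d \<Longrightarrow>
      (p k i \<bullet> y)\<^sup>2 \<le> join_vec y x \<bullet> (LMI_block v k i *v join_vec y x)"
    and k: "k < horizon d"
  shows "p k i = 0"
proof (rule ccontr)
  assume nz: "p k i \<noteq> 0"
  obtain s where s: "slater_point d s"
    using slater unfolding slater_condition_def by blast
  have v: "feasible_up_to_LMI d v"
    using opt unfolding optimal_solution_def feasible_iff_LMI by blast
  define g where "g k i = join_vec (0 :: real^'u) (matrix_inv (dynA d k i) *v (dynB d k i *v p k i))" for k i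
  define r where "r = (\<Sum>k<horizon d. \<Sum>i\<in>UNIV. p k i \<bullet> (costR d k *v p k i))"
  have "0 < r"
  proof -
    have R: "pos_def (costR d k)" if "k < horizon d" for k
      using data that unfolding valid_data_def by blast
    have nonneg: "0 \<le> p k i \<bullet> (costR d k *v p k i)" if "k < horizon d" for k i
      using pos_def_imp_pos_semidef[OF R[OF that]] unfolding pos_semidef_def by blast
    have "0 < p k i \<bullet> (costR d k *v p k i)"
      using R[OF k] nz unfolding pos_def_def by blast
    then have "0 < (\<Sum>i\<in>UNIV. p k i \<bullet> (costR d k *v p k i))"
      using nonneg[OF k] by (intro sum_pos2[of _ i]) auto
    then show ?thesis
      unfolding r_def using k nonneg by (intro sum_pos2[of _ k] sum_nonneg) auto
  qed
  obtain C where C: "0 \<le> C"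
    "\<And>k i z. k < horizon d \<Longrightarrow> (g k i \<bullet> z)\<^sup>2 \<le> C * (z \<bullet> (LMI_block s k i *v z))"
  proof -
    have "\<exists>C\<ge>0. \<forall>z. (g k i \<bullet> z)\<^sup>2 \<le> C * (z \<bullet> (LMI_block s k i *v z))" if "k < horizon d" for k i
      using s that pos_def_dominates_rank_one[of "LMI_block s k i" "g k i"]
      unfolding slater_point_def by metis
    then obtain c where c: "\<And>k i. k < horizon d \<Longrightarrow> 0 \<le> c k i"
      "\<And>k i z. k < horizon d \<Longrightarrow> (g k i \<bullet> z)\<^sup>2 \<le> c k i * (z \<bullet> (LMI_block s k i *v z))"
      by metis
    \<comment> \<open>A sum of the nonnegative constants is a bound uniform in time and mode.\<close>
    define C where "C = (\<Sum>k<horizon d. \<Sum>i\<in>UNIV. c k i)"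
    have "c k i \<le> C" if "k < horizon d" for k i
    proof -
      have "c k i \<le> (\<Sum>i\<in>UNIV. c k i)"
        using c(1)[OF that] by (intro member_le_sum) auto
      also have "\<dots> \<le> C"
        unfolding C_def using that c(1)
        by (intro member_le_sum[of k "{..<horizon d}" "\<lambda>k. \<Sum>i\<in>UNIV. c k i"] sum_nonneg) auto
      finally show ?thesis .
    qed
    moreover have "0 \<le> z \<bullet> (LMI_block s k i *v z)" if "k < horizon d" for k i z
      using s that pos_def_imp_pos_semidef unfolding slater_point_def pos_semidef_def by blast
    ultimately have "(g k i \<bullet> z)\<^sup>2 \<le> C * (z \<bullet> (LMI_block s k i *v z))" if "k < horizon d" for k i z
      using that c(2)[OF that] by (blast intro: order_trans mult_right_mono)
    moreover have "0 \<le> C"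
      unfolding C_def using c(1) by (intro sum_nonneg) auto
    ultimately show thesis
      using that by blast
  qed
  define J where "J = objective d s - objective d v"
  obtain \<epsilon> where \<epsilon>: "0 < \<epsilon>" "\<epsilon> \<le> 1 / 4" "2 * \<epsilon>\<^sup>2 * C \<le> 1"
    "2 * \<epsilon>\<^sup>2 * C * J < (1 - 2 * \<epsilon>\<^sup>2 * C) * (2 * \<epsilon> * r)"
  proof -
    have "((\<lambda>\<epsilon>. 2 * \<epsilon>\<^sup>2 * C) \<longlongrightarrow> 2 * 0\<^sup>2 * C) (at_right 0)"
      by (intro tendsto_intros)
    then have ev1: "\<forall>\<^sub>F \<epsilon> in at_right 0. 2 * \<epsilon>\<^sup>2 * C < 1"
      by (rule order_tendstoD) simp
    have "((\<lambda>\<epsilon>. 2 * \<epsilon> * C * J - (1 - 2 * \<epsilon>\<^sup>2 * C) * (2 * r))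
        \<longlongrightarrow> 2 * 0 * C * J - (1 - 2 * 0\<^sup>2 * C) * (2 * r)) (at_right 0)"
      by (intro tendsto_intros)
    then have ev2: "\<forall>\<^sub>F \<epsilon> in at_right 0. 2 * \<epsilon> * C * J - (1 - 2 * \<epsilon>\<^sup>2 * C) * (2 * r) < 0"
      by (rule order_tendstoD) (use \<open>0 < r\<close> in simp)
    have ev3: "\<forall>\<^sub>F \<epsilon> in at_right 0. \<epsilon> < (1 / 4 :: real)"
      by (rule order_tendstoD(2)[OF tendsto_ident_at]) simp
    have ev4: "\<forall>\<^sub>F \<epsilon> in at_right (0::real). 0 < \<epsilon>"
      by (rule eventually_at_right_less)
    obtain \<epsilon> where e: "2 * \<epsilon>\<^sup>2 * C < 1" "2 * \<epsilon> * C * J - (1 - 2 * \<epsilon>\<^sup>2 * C) * (2 * r) < 0"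
      "\<epsilon> < 1 / 4" "0 < \<epsilon>"
      using eventually_happens[OF eventually_conj[OF ev1 eventually_conj[OF ev2 eventually_conj[OF ev3 ev4]]]]
      by auto
    \<comment> \<open>The limit was taken after division by \<open>\<epsilon>\<close>, since at \<open>\<epsilon> = 0\<close> both sides of the claim vanish.\<close>
    have "\<epsilon> * (2 * \<epsilon> * C * J - (1 - 2 * \<epsilon>\<^sup>2 * C) * (2 * r)) < 0"
      using e(2,4) by (rule mult_pos_neg[rotated])
    then have "2 * \<epsilon>\<^sup>2 * C * J < (1 - 2 * \<epsilon>\<^sup>2 * C) * (2 * \<epsilon> * r)"
      by (simp add: power2_eq_square algebra_simps)
    then show thesis
      using that e by auto
  qed
  define \<theta> where "\<theta> = 2 * \<epsilon>\<^sup>2 * C"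
  have \<theta>: "0 \<le> \<theta>" "\<theta> \<le> 1"
    using C(1) \<epsilon>(3) unfolding \<theta>_def by simp_all
  define t where "t = covariance_neutral_step d p \<epsilon> v"
  define u where "u = decision_mix \<theta> t s"
  have t: "feasible_up_to_LMI d t"
    unfolding t_def using \<epsilon>(1) by (intro feasible_up_to_LMI_covariance_neutral_step data rho v) simp
  have u: "feasible_up_to_LMI d u"
    unfolding u_def
    by (intro feasible_up_to_LMI_decision_mix data \<theta> t slater_point_feasible_up_to_LMI s)
  have "pos_semidef (LMI_block u k i)" if "k < horizon d" for k i
    unfolding pos_semidef_def
  proof (intro conjI allI)
    show "symmetric_mat (LMI_block u k i)"
      using u that unfolding feasible_up_to_LMI_def symmetric_vars_def
      by (intro block_mat_symmetric) auto
  next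
    fix z :: "real^('u + 'x)"
    define b where "b = (g k i \<bullet> z)\<^sup>2"
    have "0 \<le> b" unfolding b_def by simp
    have step: "- 2 * \<epsilon>\<^sup>2 * b \<le> z \<bullet> (LMI_block t k i *v z)"
      unfolding b_def g_def t_def using \<epsilon> dom[OF that]
      by (intro LMI_defect_covariance_neutral_step) auto
    have "2 * \<epsilon>\<^sup>2 * b \<le> \<theta> * (z \<bullet> (LMI_block s k i *v z))"
      using mult_left_mono[OF C(2)[OF that, of i z], of "2 * \<epsilon>\<^sup>2"] unfolding b_def \<theta>_def
      by (simp add: mult.assoc)
    moreover have "- 2 * \<epsilon>\<^sup>2 * b \<le> (1 - \<theta>) * (- 2 * \<epsilon>\<^sup>2 * b)"
      using \<theta>(1) \<open>0 \<le> b\<close> by (simp add: algebra_simps)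
    moreover have "(1 - \<theta>) * (- 2 * \<epsilon>\<^sup>2 * b) \<le> (1 - \<theta>) * (z \<bullet> (LMI_block t k i *v z))"
      using step \<theta>(2) by (intro mult_left_mono) auto
    ultimately show "0 \<le> z \<bullet> (LMI_block u k i *v z)"
      unfolding u_def decision_mix_simps block_mat_linear_combination
        quadratic_form_linear_combination by linarith
  qed
  then have "feasible d u"
    using u unfolding feasible_iff_LMI by blast
  then have "objective d v \<le> objective d u"
    using opt unfolding optimal_solution_def by blast
  also have "\<dots> \<le> (1 - \<theta>) * objective d t + \<theta> * objective d s"
    unfolding u_def by (intro objective_decision_mix_le data \<theta>)
  also have "objective d t = objective d v - 2 * \<epsilon> * r"
    unfolding t_def r_def by (rule objective_covariance_neutral_step)
  finally have "(1 - \<theta>) * (2 * \<epsilon> * r) \<le> \<theta> * J"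
    unfolding J_def by (simp add: algebra_simps)
  then show False
    using \<epsilon>(4) unfolding \<theta>_def by simp
qed

theorem theorem2:
  fixes d :: "('x::finite, 'u::finite, 'w::finite, 's::finite) mjls_data"
    and v :: "('x, 'u, 's) decision"
  assumes "valid_data d"
    and "mean_trajectory d"
    and "\<forall>k\<le>horizon d. \<forall>i. 0 < rho d k $ i"
    and "slater_condition d"
    and "optimal_solution d v"
    and "\<forall>k\<le>horizon d. \<forall>i. pos_def (varS v k i)"
  shows "\<forall>k<horizon d. \<forall>i.
           varY v k i = varL v k i ** matrix_inv (varS v k i) ** transpose (varL v k i)"
proof (intro allI impI, rule ccontr)
  fix k i
  assume k: "k < horizon d"
    and neq: "varY v k i \<noteq> varL v k i ** matrix_inv (varS v k i) ** transpose (varL v k i)"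
  have psd: "pos_semidef (LMI_block v k i)" if "k < horizon d" for k i
    using assms(5) that unfolding optimal_solution_def feasible_def by blast
  have "symmetric_mat (varY v k i)"
    using assms(5) k unfolding optimal_solution_def feasible_def symmetric_vars_def by blast
  then obtain p0 where p0: "p0 \<noteq> 0"
    "\<And>y x. (p0 \<bullet> y)\<^sup>2 \<le> join_vec y x \<bullet> (LMI_block v k i *v join_vec y x)"
    using nonzero_Schur_complement_dominates_rank_one[OF psd[OF k]] assms(6) k neq
    by (metis less_imp_le)
  \<comment> \<open>Only the offending time and mode are perturbed; elsewhere the zero vector is dominated.\<close>
  define p where "p k' i' = (if k' = k \<and> i' = i then p0 else 0)" for k' i'
  have "(p k' i' \<bullet> y)\<^sup>2 \<le> join_vec y x \<bullet> (LMI_block v k' i' *v join_vec y x)"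
    if "k' < horizon d" for k' i' y x
    using p0(2) psd[OF that] unfolding p_def pos_semidef_def by simp
  then have "p k i = 0"
    using assms k by (intro optimal_dominated_direction_eq_0[of d v p])
  then show False
    using p0(1) unfolding p_def by simp
qed

end
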